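(* Assume: (1) $\mathcal H=\bigoplus_{n\ge0}\mathcal H_n$ is a graded connected Hopf algebra over $\mathbb R$, each $\mathcal H_n$ finite-dimensional with basis $\mathcal B_n$, and $\mathcal B=\coprod_n\mathcal B_n$; (2) $\tau:\mathcal B\to\mathcal B$ is a graded involution whose linear extension is a Hopf ambimorphism of $\mathcal H$; (3) $n$ is fixed and $P$ is a probability distribution on signed weak-compositions of $n$, or on tilde-signed weak-compositions of $n$ (not a mixture), and $m\circ\Delta_{P(\tau)}:=\sum_D\frac{P(D)}{\binom{n}{D^+}}m\circ\Delta_{D(\tau)}$; (4) for each $D=(d_1,\dots,d_l)$ with $P(D)>0$, all $x\in\mathcal B_n$ and all $z_i\in\mathcal B_{|d_i|}$: $z_1\cdots z_l=\sum_{y\in\mathcal B_n}\xi^y_{z_1,\dots,z_l}y$ with all $\xi^y_{z_1,\dots,z_l}\ge0$, and $\Delta_{D^+}(x)=\sum\eta_x^{z_1,\dots,z_l}z_1\otimes\cdots\otimes z_l$ with all $\eta_x^{z_1,\dots,z_l}\ge0$; (5) $\eta(x)>0$ for all $x\in\mathcal B_n$. Then the matrix $$K(x,y):=\frac{\eta(y)}{\eta(x)}\cdot\big(\text{coefficient of }y\text{ in }m\circ\Delta_{P(\tau)}(x)\big),\qquad x,y\in\mathcal B_n,$$ is a transition matrix (nonnegative with rows summing to $1$), and $K(x,y)$ equals the probability that the following process, started at $x$, produces $y$: 1. Choose $D$ according to $P$. 2. Choose $z_1\in\mathcal B_{|d_1|},\dots,z_l\in\mathcal B_{|d_l|}$ with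 probability $\frac{1}{\eta(x)}\eta_x^{z_1,\dots,z_l}\eta(z_1)\cdots\eta(z_l)$. 3. For each $i$ with $d_i$ decorated, replace $z_i$ by $\tau(z_i)$; call the results $z'_1,\dots,z'_l$. 4. Choose $y\in\mathcal B_n$ with probability $\big(\binom{n}{D^+}\eta(z_1)\cdots\eta(z_l)\big)^{-1}\xi^y_{z'_1,\dots,z'_l}\eta(y)$.
   Context: Graded connected Hopf algebra: $\mathcal H_0=\mathbb R\cdot1$, product $m$ (iterated products also denoted $m$), coproduct $\Delta$; $\Delta^{[l]}$ iterated coproduct; for a weak-composition $E=(e_1,\dots,e_l)$ of $n$ (nonnegative integers summing to $n$), $\Delta_E$ is $\Delta^{[l]}$ on $\mathcal H_n$ projected to $\mathcal H_{e_1}\otimes\cdots\otimes\mathcal H_{e_l}$. A Hopf ambimorphism is a linear map that is an algebra morphism or antimorphism and a coalgebra morphism or antimorphism. A signed (resp. tilde-signed) weak-composition is a weak-composition with some parts decorated by a bar (resp. tilde-bar); $D^+=(|d_1|,\dots,|d_l|)$ forgets decorations; $\binom{n}{D^+}$ is the multinomial coefficient. $m\circ\Delta_{D(\tau)}$: apply $\Delta_{D^+}$, then $\tau$ on tensor factors corresponding to decorated parts, then multiply. For a basis element $x$ of any degree $j$, $\eta(x)$ is the sum of the coefficients of $\Delta_{1,\dots,1}(x)$ (with $j$ ones) in the basis $\mathcal B_1\otimes\cdots\otimes\mathcal B_1$ (with $\eta=1$ on $\mathcal B_0=\{1\}$). *)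

theory Defs
  imports "HOL-Probability.Probability" "HOL-Library.Poly_Mapping"
begin

section \<open>The tensor algebra of a real vector space\<close>

instantiation poly_mapping :: (type, real_vector) real_vector
begin

lift_definition scaleR_poly_mapping :: "real \<Rightarrow> ('a \<Rightarrow>\<^sub>0 'b) \<Rightarrow> ('a \<Rightarrow>\<^sub>0 'b)"
  is "\<lambda>c f x. c *\<^sub>R f x"
  by (rule finite_subset) auto

instance
  by standard (transfer; simp add: fun_eq_iff scaleR_add_right scaleR_add_left)+

end

lemma lookup_scaleR [simp]: "Poly_Mapping.lookup (c *\<^sub>R p) k = c *\<^sub>R Poly_Mapping.lookup p k"
  by transfer simp

definition multilinear_relations :: "('a::real_vector list \<Rightarrow>\<^sub>0 real) set" where
  "multilinear_relations =
     {Poly_Mapping.single (us @ (a *\<^sub>R x + b *\<^sub>R y) # vs) 1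
        - a *\<^sub>R Poly_Mapping.single (us @ x # vs) 1
        - b *\<^sub>R Poly_Mapping.single (us @ y # vs) 1 | us vs a b x y. True}"

definition tensor_eq :: "('a::real_vector list \<Rightarrow>\<^sub>0 real) \<Rightarrow> ('a list \<Rightarrow>\<^sub>0 real) \<Rightarrow> bool" where
  "tensor_eq p q \<longleftrightarrow> p - q \<in> span multilinear_relations"

text \<open>
  The type \<open>'a tensor\<close> is the direct sum of all tensor powers of \<open>'a\<close>: the free vector space on
  finite lists, modulo linearity in each list entry.
\<close>

quotient_type (overloaded) 'a tensor = "'a::real_vector list \<Rightarrow>\<^sub>0 real" / tensor_eq
proof (rule equivpI)
  show "reflp (tensor_eq :: ('a list \<Rightarrow>\<^sub>0 real) \<Rightarrow> _)"
    by (simp add: reflp_def tensor_eq_def span_zero)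
  show "symp (tensor_eq :: ('a list \<Rightarrow>\<^sub>0 real) \<Rightarrow> _)"
    unfolding symp_def tensor_eq_def by (auto dest: span_neg)
  show "transp (tensor_eq :: ('a list \<Rightarrow>\<^sub>0 real) \<Rightarrow> _)"
  proof (rule transpI)
    fix p q r :: "'a list \<Rightarrow>\<^sub>0 real"
    assume "tensor_eq p q" "tensor_eq q r"
    then have "(p - q) + (q - r) \<in> span multilinear_relations"
      unfolding tensor_eq_def by (rule span_add)
    then show "tensor_eq p r" by (simp add: tensor_eq_def)
  qed
qed

instantiation tensor :: (real_vector) real_vector
begin

lift_definition zero_tensor :: "'a tensor" is 0 .

lift_definition plus_tensor :: "'a tensor \<Rightarrow> 'a tensor \<Rightarrow> 'a tensor" is "(+)"
  unfolding tensor_eq_def by (simp only: add_diff_add span_add)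

lift_definition uminus_tensor :: "'a tensor \<Rightarrow> 'a tensor" is uminus
  unfolding tensor_eq_def by (simp only: minus_diff_minus span_neg)

lift_definition minus_tensor :: "'a tensor \<Rightarrow> 'a tensor \<Rightarrow> 'a tensor" is "(-)"
proof -
  fix p p' q q' :: "'a list \<Rightarrow>\<^sub>0 real"
  assume "tensor_eq p p'" "tensor_eq q q'"
  moreover have "p - q - (p' - q') = (p - p') - (q - q')" by simp
  ultimately show "tensor_eq (p - q) (p' - q')"
    unfolding tensor_eq_def by (simp only: span_diff)
qed

lift_definition scaleR_tensor :: "real \<Rightarrow> 'a tensor \<Rightarrow> 'a tensor" is scaleR
  unfolding tensor_eq_def by (simp only: scaleR_diff_right[symmetric] span_scale)

instance
  by standard
    (transfer; simp add: tensor_eq_def span_zero scaleR_add_right scaleR_add_left algebra_simps)+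

end

lift_definition pure_tensor :: "'a::real_vector list \<Rightarrow> 'a tensor"
  is "\<lambda>xs. Poly_Mapping.single xs 1" .

definition multilinear :: "('a::real_vector list \<Rightarrow> 'b::real_vector) \<Rightarrow> bool" where
  "multilinear f \<longleftrightarrow> (\<forall>us vs. linear (\<lambda>x. f (us @ x # vs)))"

text \<open>
  The linear map on tensors induced by a multilinear \<open>f\<close>.  It is meaningful only if \<open>f\<close> is
  multilinear on lists of every length, hence the value 0 below on lists of the wrong length.
\<close>

definition tensor_lift :: "('a::real_vector list \<Rightarrow> 'b::real_vector) \<Rightarrow> 'a tensor \<Rightarrow> 'b" where
  "tensor_lift f t =
     (\<Sum>xs\<in>Poly_Mapping.keys (rep_tensor t). Poly_Mapping.lookup (rep_tensor t) xs *\<^sub>R f xs)"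

lemma tensor_lift_abs:
  assumes f: "multilinear f"
  shows "tensor_lift f (abs_tensor p)
       = (\<Sum>xs\<in>Poly_Mapping.keys p. Poly_Mapping.lookup p xs *\<^sub>R f xs)"
proof -
  define F where "F p = (\<Sum>xs\<in>Poly_Mapping.keys p. Poly_Mapping.lookup p xs *\<^sub>R f xs)" for p
  have F_superset: "F p = (\<Sum>xs\<in>A. Poly_Mapping.lookup p xs *\<^sub>R f xs)"
    if "finite A" "Poly_Mapping.keys p \<subseteq> A" for p A
    unfolding F_def using that
    by (intro sum.mono_neutral_left) (auto simp: in_keys_iff)
  have F_linear: "linear F"
  proof (rule linearI)
    fix p q :: "'a list \<Rightarrow>\<^sub>0 real" and c :: real
    let ?A = "Poly_Mapping.keys p \<union> Poly_Mapping.keys q"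
    have "Poly_Mapping.keys (p + q) \<subseteq> ?A" by (rule Poly_Mapping.keys_add)
    then show "F (p + q) = F p + F q"
      by (simp add: F_superset[of ?A] lookup_add scaleR_add_left sum.distrib)
    have "Poly_Mapping.keys (c *\<^sub>R p) \<subseteq> Poly_Mapping.keys p"
      by (auto simp: in_keys_iff)
    then have "F (c *\<^sub>R p) = (\<Sum>xs\<in>Poly_Mapping.keys p. Poly_Mapping.lookup (c *\<^sub>R p) xs *\<^sub>R f xs)"
      by (intro F_superset) auto
    then show "F (c *\<^sub>R p) = c *\<^sub>R F p"
      by (simp add: F_def scaleR_sum_right)
  qed
  have F_single: "F (Poly_Mapping.single xs 1) = f xs" for xs
    by (simp add: F_def)
  have F_rel: "F r = 0" if rel: "r \<in> multilinear_relations" for r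
  proof -
    obtain us vs a b x y where r: "r =
        Poly_Mapping.single (us @ (a *\<^sub>R x + b *\<^sub>R y) # vs) 1
        - a *\<^sub>R Poly_Mapping.single (us @ x # vs) 1
        - b *\<^sub>R Poly_Mapping.single (us @ y # vs) 1"
      using rel unfolding multilinear_relations_def by blast
    have "linear (\<lambda>x. f (us @ x # vs))"
      using f by (simp add: multilinear_def)
    then have "f (us @ (a *\<^sub>R x + b *\<^sub>R y) # vs) = a *\<^sub>R f (us @ x # vs) + b *\<^sub>R f (us @ y # vs)"
      using linear_add[of "\<lambda>x. f (us @ x # vs)"] linear_scale[of "\<lambda>x. f (us @ x # vs)"] by simp
    then show ?thesis
      unfolding r by (simp add: linear_diff[OF F_linear] linear_scale[OF F_linear] F_single)
  qed
  have F_span: "F r = 0" if "r \<in> span multilinear_relations" for r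
    using F_linear F_rel that by (rule linear_eq_0_on_span)
  have "tensor_eq (rep_tensor (abs_tensor p)) p"
    by (rule Quotient3_rep_abs[OF Quotient3_tensor]) (simp add: tensor_eq_def span_zero)
  then have "F (rep_tensor (abs_tensor p) - p) = 0"
    unfolding tensor_eq_def by (rule F_span)
  then have "F (rep_tensor (abs_tensor p)) = F p"
    by (simp add: linear_diff[OF F_linear])
  then show ?thesis
    by (simp add: tensor_lift_def F_def)
qed

lemma tensor_lift_pure: "multilinear f \<Longrightarrow> tensor_lift f (pure_tensor xs) = f xs"
  by (simp add: pure_tensor.abs_eq tensor_lift_abs)

text \<open>
  The concatenation product of tensors, and the tensor product \<open>f\<^sub>1 \<otimes> \<dots> \<otimes> f\<^sub>l\<close> of linear maps
  \<open>f\<^sub>i\<close> into tensor powers; a map into \<open>'b\<close> itself is composed with \<open>tensor_of\<close>.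
\<close>

definition tensor_concat :: "'a::real_vector tensor \<Rightarrow> 'a tensor \<Rightarrow> 'a tensor" where
  "tensor_concat s t = tensor_lift (\<lambda>xs. tensor_lift (\<lambda>ys. pure_tensor (xs @ ys)) t) s"

definition tensor_of :: "'a::real_vector \<Rightarrow> 'a tensor" where
  "tensor_of x = pure_tensor [x]"

definition tensor_maps ::
    "('a::real_vector \<Rightarrow> 'b::real_vector tensor) list \<Rightarrow> 'a tensor \<Rightarrow> 'b tensor" where
  "tensor_maps fs = tensor_lift (\<lambda>xs.
     if length xs = length fs
     then foldr tensor_concat (map2 (\<lambda>f x. f x) fs xs) (pure_tensor [])
     else 0)"

definition tensor_times :: "'a::real_algebra tensor \<Rightarrow> 'a tensor \<Rightarrow> 'a tensor" where
  "tensor_times s t = tensor_lift (\<lambda>xs. tensor_lift (\<lambda>ys.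
     if length xs = length ys then pure_tensor (map2 (*) xs ys) else 0) t) s"

definition tensor_rev :: "'a::real_vector tensor \<Rightarrow> 'a tensor" where
  "tensor_rev = tensor_lift (\<lambda>xs. pure_tensor (rev xs))"

definition tensor_mult :: "'a::real_algebra_1 tensor \<Rightarrow> 'a" where
  "tensor_mult = tensor_lift prod_list"

section \<open>Graded connected Hopf algebras\<close>

definition graded_vector_space :: "(nat \<Rightarrow> 'h::real_vector set) \<Rightarrow> bool" where
  "graded_vector_space H \<longleftrightarrow>
     (\<forall>n. subspace (H n)) \<and> span (\<Union>n. H n) = UNIV \<and>
     (\<forall>n. H n \<inter> span (\<Union>k\<in>- {n}. H k) = {0})"

definition graded_proj :: "(nat \<Rightarrow> 'h::real_vector set) \<Rightarrow> nat \<Rightarrow> 'h \<Rightarrow> 'h" where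
  "graded_proj H n v = (THE u. u \<in> H n \<and> v - u \<in> span (\<Union>k\<in>- {n}. H k))"

text \<open>A linear functional, viewed as a map into the 0th tensor power.\<close>

definition scalar_tensor :: "('h::real_vector \<Rightarrow> real) \<Rightarrow> 'h \<Rightarrow> 'h tensor" where
  "scalar_tensor \<epsilon> x = \<epsilon> x *\<^sub>R pure_tensor []"

locale graded_connected_hopf_algebra =
  fixes H :: "nat \<Rightarrow> 'h::real_algebra_1 set"
    and \<Delta> :: "'h \<Rightarrow> 'h tensor"
    and \<epsilon> :: "'h \<Rightarrow> real"
  assumes graded: "graded_vector_space H"
    and connected: "H 0 = span {1}"
    and mult_graded: "x \<in> H i \<Longrightarrow> y \<in> H j \<Longrightarrow> x * y \<in> H (i + j)"
    and coprod_linear: "linear \<Delta>"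
    and coprod_graded:
      "x \<in> H n \<Longrightarrow> \<Delta> x \<in> span (\<Union>i\<le>n. {pure_tensor [u, v] | u v. u \<in> H i \<and> v \<in> H (n - i)})"
    and counit_linear: "linear \<epsilon>"
    and counit_graded: "x \<in> H n \<Longrightarrow> n > 0 \<Longrightarrow> \<epsilon> x = 0"
    and coassoc: "tensor_maps [\<Delta>, tensor_of] (\<Delta> x) = tensor_maps [tensor_of, \<Delta>] (\<Delta> x)"
    and counit_left: "tensor_maps [scalar_tensor \<epsilon>, tensor_of] (\<Delta> x) = tensor_of x"
    and counit_right: "tensor_maps [tensor_of, scalar_tensor \<epsilon>] (\<Delta> x) = tensor_of x"
    and coprod_mult: "\<Delta> (x * y) = tensor_times (\<Delta> x) (\<Delta> y)"
    and coprod_one: "\<Delta> 1 = pure_tensor [1, 1]"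
    and counit_mult: "\<epsilon> (x * y) = \<epsilon> x * \<epsilon> y"
    and counit_one: "\<epsilon> 1 = 1"
    and antipode: "\<exists>S. linear S \<and>
      (\<forall>x. tensor_mult (tensor_maps [tensor_of \<circ> S, tensor_of] (\<Delta> x)) = \<epsilon> x *\<^sub>R 1) \<and>
      (\<forall>x. tensor_mult (tensor_maps [tensor_of, tensor_of \<circ> S] (\<Delta> x)) = \<epsilon> x *\<^sub>R 1)"

fun iterated_coprod ::
    "('h::real_vector \<Rightarrow> 'h tensor) \<Rightarrow> ('h \<Rightarrow> real) \<Rightarrow> nat \<Rightarrow> 'h \<Rightarrow> 'h tensor" where
  "iterated_coprod \<Delta> \<epsilon> 0 = scalar_tensor \<epsilon>"
| "iterated_coprod \<Delta> \<epsilon> (Suc 0) = tensor_of"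
| "iterated_coprod \<Delta> \<epsilon> (Suc (Suc l)) =
     (\<lambda>x. tensor_maps [tensor_of, iterated_coprod \<Delta> \<epsilon> (Suc l)] (\<Delta> x))"

definition coprod_comp ::
    "(nat \<Rightarrow> 'h::real_vector set) \<Rightarrow> ('h \<Rightarrow> 'h tensor) \<Rightarrow> ('h \<Rightarrow> real) \<Rightarrow> nat list \<Rightarrow> 'h \<Rightarrow> 'h tensor"
  where
  "coprod_comp H \<Delta> \<epsilon> E x =
     tensor_maps (map (\<lambda>e. tensor_of \<circ> graded_proj H e) E) (iterated_coprod \<Delta> \<epsilon> (length E) x)"

definition algebra_morphism :: "('h::real_algebra_1 \<Rightarrow> 'h) \<Rightarrow> bool" where
  "algebra_morphism f \<longleftrightarrow> linear f \<and> f 1 = 1 \<and> (\<forall>x y. f (x * y) = f x * f y)"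

definition algebra_antimorphism :: "('h::real_algebra_1 \<Rightarrow> 'h) \<Rightarrow> bool" where
  "algebra_antimorphism f \<longleftrightarrow> linear f \<and> f 1 = 1 \<and> (\<forall>x y. f (x * y) = f y * f x)"

definition coalgebra_morphism ::
    "('h::real_vector \<Rightarrow> 'h tensor) \<Rightarrow> ('h \<Rightarrow> real) \<Rightarrow> ('h \<Rightarrow> 'h) \<Rightarrow> bool" where
  "coalgebra_morphism \<Delta> \<epsilon> f \<longleftrightarrow> linear f \<and> (\<forall>x. \<epsilon> (f x) = \<epsilon> x) \<and>
     (\<forall>x. \<Delta> (f x) = tensor_maps [tensor_of \<circ> f, tensor_of \<circ> f] (\<Delta> x))"

definition coalgebra_antimorphism ::
    "('h::real_vector \<Rightarrow> 'h tensor) \<Rightarrow> ('h \<Rightarrow> real) \<Rightarrow> ('h \<Rightarrow> 'h) \<Rightarrow> bool" where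
  "coalgebra_antimorphism \<Delta> \<epsilon> f \<longleftrightarrow> linear f \<and> (\<forall>x. \<epsilon> (f x) = \<epsilon> x) \<and>
     (\<forall>x. \<Delta> (f x) = tensor_rev (tensor_maps [tensor_of \<circ> f, tensor_of \<circ> f] (\<Delta> x)))"

definition hopf_ambimorphism ::
    "('h::real_algebra_1 \<Rightarrow> 'h tensor) \<Rightarrow> ('h \<Rightarrow> real) \<Rightarrow> ('h \<Rightarrow> 'h) \<Rightarrow> bool" where
  "hopf_ambimorphism \<Delta> \<epsilon> f \<longleftrightarrow>
     (algebra_morphism f \<or> algebra_antimorphism f) \<and>
     (coalgebra_morphism \<Delta> \<epsilon> f \<or> coalgebra_antimorphism \<Delta> \<epsilon> f)"

definition linear_ext :: "(nat \<Rightarrow> 'h::real_vector set) \<Rightarrow> ('h \<Rightarrow> 'h) \<Rightarrow> 'h \<Rightarrow> 'h" where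
  "linear_ext B \<tau> = construct (\<Union>n. B n) \<tau>"

section \<open>Structure constants\<close>

definition mult_coeff :: "(nat \<Rightarrow> 'h::real_algebra_1 set) \<Rightarrow> nat \<Rightarrow> 'h list \<Rightarrow> 'h \<Rightarrow> real" where
  "mult_coeff B n zs y = representation (B n) (prod_list zs) y"

definition comult_coeff ::
    "(nat \<Rightarrow> 'h::real_vector set) \<Rightarrow> ('h \<Rightarrow> 'h tensor) \<Rightarrow> ('h \<Rightarrow> real) \<Rightarrow> (nat \<Rightarrow> 'h set) \<Rightarrow>
     nat list \<Rightarrow> 'h \<Rightarrow> 'h list \<Rightarrow> real" where
  "comult_coeff H \<Delta> \<epsilon> B E x zs =
     representation (pure_tensor ` listset (map B E)) (coprod_comp H \<Delta> \<epsilon> E x) (pure_tensor zs)"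

text \<open>The argument \<open>j\<close> is the degree of the basis element \<open>x\<close>.\<close>

definition eta ::
    "(nat \<Rightarrow> 'h::real_vector set) \<Rightarrow> ('h \<Rightarrow> 'h tensor) \<Rightarrow> ('h \<Rightarrow> real) \<Rightarrow> (nat \<Rightarrow> 'h set) \<Rightarrow>
     nat \<Rightarrow> 'h \<Rightarrow> real" where
  "eta H \<Delta> \<epsilon> B j x =
     (if j = 0 then 1
      else \<Sum>zs\<in>listset (replicate j (B 1)). comult_coeff H \<Delta> \<epsilon> B (replicate j 1) x zs)"

definition eta_prod ::
    "(nat \<Rightarrow> 'h::real_vector set) \<Rightarrow> ('h \<Rightarrow> 'h tensor) \<Rightarrow> ('h \<Rightarrow> real) \<Rightarrow> (nat \<Rightarrow> 'h set) \<Rightarrow>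
     nat list \<Rightarrow> 'h list \<Rightarrow> real" where
  "eta_prod H \<Delta> \<epsilon> B E zs = prod_list (map2 (eta H \<Delta> \<epsilon> B) E zs)"

section \<open>Decorated weak-compositions and the associated operators\<close>

datatype decoration = Plain | Bar | Tilde_Bar

type_synonym decorated_composition = "(nat \<times> decoration) list"

abbreviation forget :: "decorated_composition \<Rightarrow> nat list" where
  "forget \<equiv> map fst"

definition signed_weak_compositions :: "nat \<Rightarrow> decorated_composition set" where
  "signed_weak_compositions n = {D. sum_list (forget D) = n \<and> Tilde_Bar \<notin> set (map snd D)}"

definition tilde_signed_weak_compositions :: "nat \<Rightarrow> decorated_composition set" where
  "tilde_signed_weak_compositions n = {D. sum_list (forget D) = n \<and> Bar \<notin> set (map snd D)}"

definition multinomial :: "nat list \<Rightarrow> real" where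
  "multinomial E = fact (sum_list E) / prod_list (map fact E)"

definition decorated_maps :: "('h \<Rightarrow> 'h) \<Rightarrow> decorated_composition \<Rightarrow> ('h \<Rightarrow> 'h) list" where
  "decorated_maps f D = map (\<lambda>(d, c). if c = Plain then id else f) D"

text \<open>The operator \<open>m \<circ> \<Delta>\<^bsub>D(f)\<^esub>\<close>, for \<open>f\<close> a linear map.\<close>

definition mult_comult ::
    "(nat \<Rightarrow> 'h::real_algebra_1 set) \<Rightarrow> ('h \<Rightarrow> 'h tensor) \<Rightarrow> ('h \<Rightarrow> real) \<Rightarrow>
     ('h \<Rightarrow> 'h) \<Rightarrow> decorated_composition \<Rightarrow> 'h \<Rightarrow> 'h" where
  "mult_comult H \<Delta> \<epsilon> f D x =
     tensor_mult (tensor_maps (map ((\<circ>) tensor_of) (decorated_maps f D))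
       (coprod_comp H \<Delta> \<epsilon> (forget D) x))"

text \<open>
  The operator \<open>m \<circ> \<Delta>\<^bsub>P(f)\<^esub>\<close> on the degree \<open>n\<close> part.  A number has infinitely many
  weak-compositions, so the sum over \<open>D\<close> is an infinite one in a finite-dimensional space; it is
  taken coordinatewise.
\<close>

definition mult_comult_dist ::
    "(nat \<Rightarrow> 'h::real_algebra_1 set) \<Rightarrow> ('h \<Rightarrow> 'h tensor) \<Rightarrow> ('h \<Rightarrow> real) \<Rightarrow> (nat \<Rightarrow> 'h set) \<Rightarrow>
     ('h \<Rightarrow> 'h) \<Rightarrow> nat \<Rightarrow> decorated_composition pmf \<Rightarrow> 'h \<Rightarrow> 'h" where
  "mult_comult_dist H \<Delta> \<epsilon> B f n P x =
     (\<Sum>y\<in>B n. (\<Sum>\<^sub>\<infinity>D. pmf P D / multinomial (forget D) *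
        representation (B n) (mult_comult H \<Delta> \<epsilon> f D x) y) *\<^sub>R y)"

definition transition ::
    "(nat \<Rightarrow> 'h::real_algebra_1 set) \<Rightarrow> ('h \<Rightarrow> 'h tensor) \<Rightarrow> ('h \<Rightarrow> real) \<Rightarrow> (nat \<Rightarrow> 'h set) \<Rightarrow>
     ('h \<Rightarrow> 'h) \<Rightarrow> nat \<Rightarrow> decorated_composition pmf \<Rightarrow> 'h \<Rightarrow> 'h \<Rightarrow> real" where
  "transition H \<Delta> \<epsilon> B \<tau> n P x y =
     eta H \<Delta> \<epsilon> B n y / eta H \<Delta> \<epsilon> B n x *
     representation (B n) (mult_comult_dist H \<Delta> \<epsilon> B (linear_ext B \<tau>) n P x) y"

section \<open>The random process\<close>

definition split_prob ::
    "(nat \<Rightarrow> 'h::real_algebra_1 set) \<Rightarrow> ('h \<Rightarrow> 'h tensor) \<Rightarrow> ('h \<Rightarrow> real) \<Rightarrow> (nat \<Rightarrow> 'h set) \<Rightarrow>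
     nat \<Rightarrow> decorated_composition \<Rightarrow> 'h \<Rightarrow> 'h list \<Rightarrow> real" where
  "split_prob H \<Delta> \<epsilon> B n D x zs =
     (if zs \<in> listset (map B (forget D))
      then 1 / eta H \<Delta> \<epsilon> B n x * comult_coeff H \<Delta> \<epsilon> B (forget D) x zs *
           eta_prod H \<Delta> \<epsilon> B (forget D) zs
      else 0)"

definition apply_decorations :: "('h \<Rightarrow> 'h) \<Rightarrow> decorated_composition \<Rightarrow> 'h list \<Rightarrow> 'h list" where
  "apply_decorations \<tau> D zs = map2 (\<lambda>g z. g z) (decorated_maps \<tau> D) zs"

definition merge_prob ::
    "(nat \<Rightarrow> 'h::real_algebra_1 set) \<Rightarrow> ('h \<Rightarrow> 'h tensor) \<Rightarrow> ('h \<Rightarrow> real) \<Rightarrow> (nat \<Rightarrow> 'h set) \<Rightarrow>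
     ('h \<Rightarrow> 'h) \<Rightarrow> nat \<Rightarrow> decorated_composition \<Rightarrow> 'h list \<Rightarrow> 'h \<Rightarrow> real" where
  "merge_prob H \<Delta> \<epsilon> B \<tau> n D zs y =
     (if y \<in> B n
      then inverse (multinomial (forget D) * eta_prod H \<Delta> \<epsilon> B (forget D) zs) *
           mult_coeff B n (apply_decorations \<tau> D zs) y * eta H \<Delta> \<epsilon> B n y
      else 0)"

text \<open>
  \<open>embed_pmf\<close> is meaningful only on functions that are nonnegative with total mass 1; for
  \<open>merge_prob\<close> this is to be expected only for those \<open>zs\<close> that \<open>split_prob\<close> gives positive mass.
\<close>

definition hopf_process ::
    "(nat \<Rightarrow> 'h::real_algebra_1 set) \<Rightarrow> ('h \<Rightarrow> 'h tensor) \<Rightarrow> ('h \<Rightarrow> real) \<Rightarrow> (nat \<Rightarrow> 'h set) \<Rightarrow>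
     ('h \<Rightarrow> 'h) \<Rightarrow> nat \<Rightarrow> decorated_composition pmf \<Rightarrow> 'h \<Rightarrow> 'h pmf" where
  "hopf_process H \<Delta> \<epsilon> B \<tau> n P x =
     bind_pmf P (\<lambda>D.
     bind_pmf (embed_pmf (split_prob H \<Delta> \<epsilon> B n D x)) (\<lambda>zs.
     embed_pmf (merge_prob H \<Delta> \<epsilon> B \<tau> n D zs)))"

end

theory Submission
  imports Defs
begin

text \<open>
  Let \<open>\<zeta>\<close> be the linear functional that is 1 on \<open>B 1\<close> and 0 on all other basis elements.  Then
  \<open>\<eta>\<close> in degree \<open>j\<close> is the \<open>j\<close>-th convolution power of \<open>\<zeta>\<close>.  Coassociativity gives
  \<open>\<Sum> \<eta>\<^sub>x\<^sup>z \<eta>(z\<^sub>1) \<cdots> \<eta>(z\<^sub>l) = \<eta>(x)\<close>, so the splitting step has total mass 1.  Since \<open>\<zeta>\<close> lives in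
  degree 1 it is a derivation relative to the counit, so its powers obey the binomial theorem and
  \<open>\<eta>(z\<^sub>1 \<cdots> z\<^sub>l)\<close> is the multinomial coefficient times \<open>\<eta>(z\<^sub>1) \<cdots> \<eta>(z\<^sub>l)\<close>: the merging step has total
  mass 1.  Finally \<open>\<tau>\<close> permutes \<open>B 1\<close>, so \<open>\<zeta> \<circ> \<tau> = \<zeta>\<close>, and \<open>\<tau>\<close> preserves \<open>\<eta>\<close>; if \<open>\<tau>\<close> reverses the
  coproduct this still holds because powers of \<open>\<zeta>\<close> commute.  Nonnegativity of
  \<open>\<eta>(z\<^sub>1) \<cdots> \<eta>(z\<^sub>l)\<close> is read off from the merging identity, as only \<open>\<eta>\<close> in degree \<open>n\<close> is known to be
  positive.
\<close>

section \<open>Linear maps on tensors\<close>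

lemma pure_tensor_combination:
  "pure_tensor (us @ (a *\<^sub>R x + b *\<^sub>R y) # vs)
     = a *\<^sub>R pure_tensor (us @ x # vs) + b *\<^sub>R pure_tensor (us @ y # vs)"
proof (transfer fixing: us a x b y vs)
  have "Poly_Mapping.single (us @ (a *\<^sub>R x + b *\<^sub>R y) # vs) 1
        - a *\<^sub>R Poly_Mapping.single (us @ x # vs) 1
        - b *\<^sub>R Poly_Mapping.single (us @ y # vs) (1::real) \<in> span multilinear_relations"
    by (rule span_base) (simp only: multilinear_relations_def, blast)
  then show "tensor_eq (Poly_Mapping.single (us @ (a *\<^sub>R x + b *\<^sub>R y) # vs) 1)
      (a *\<^sub>R Poly_Mapping.single (us @ x # vs) 1 + b *\<^sub>R Poly_Mapping.single (us @ y # vs) 1)"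
    by (simp add: tensor_eq_def diff_diff_eq)
qed

lemma multilinear_pure_tensor: "multilinear pure_tensor"
  unfolding multilinear_def
proof (intro allI linearI)
  fix us vs :: "'a list" and x y :: 'a and c :: real
  show "pure_tensor (us @ (x + y) # vs) = pure_tensor (us @ x # vs) + pure_tensor (us @ y # vs)"
    using pure_tensor_combination[of us 1 x 1 y vs] by simp
  show "pure_tensor (us @ (c *\<^sub>R x) # vs) = c *\<^sub>R pure_tensor (us @ x # vs)"
    using pure_tensor_combination[of us c x 0 x vs] by simp
qed

text \<open>A representative is the finite sum of its \<open>Poly_Mapping.single\<close> terms, and
  the class of each term is a scalar multiple of a pure tensor.\<close>

lemma tensor_in_span_pure: "t \<in> span (range pure_tensor)"
proof (induction t rule: tensor.abs_induct)
  case (1 p)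
  have single: "abs_tensor (Poly_Mapping.single k c) = c *\<^sub>R pure_tensor k" for k :: "'a list" and c
  proof -
    have "Poly_Mapping.single k c = c *\<^sub>R Poly_Mapping.single k 1"
      by (rule poly_mapping_eqI) (simp add: lookup_single when_def)
    then show ?thesis
      by (simp add: pure_tensor.abs_eq scaleR_tensor.abs_eq)
  qed
  have "abs_tensor (\<Sum>k\<in>K. Poly_Mapping.single k (Poly_Mapping.lookup p k)) \<in> span (range pure_tensor)"
    if "finite K" for K
    using that
  proof (induction K)
    case empty
    show ?case using span_zero by (simp add: zero_tensor.abs_eq[symmetric])
  next
    case (insert k K)
    then show ?case
      by (simp add: plus_tensor.abs_eq[symmetric] single span_add span_scale span_base)
  qed
  moreover have "(\<Sum>k\<in>Poly_Mapping.keys p. Poly_Mapping.single k (Poly_Mapping.lookup p k)) = p"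
    by (rule poly_mapping_eqI)
      (simp add: lookup_sum lookup_single when_def in_keys_iff)
  ultimately show ?case
    by (metis finite_keys)
qed

lemma tensor_induct [case_names pure add scale]:
  assumes "\<And>xs. Q (pure_tensor xs)"
    and "\<And>s t. Q s \<Longrightarrow> Q t \<Longrightarrow> Q (s + t)"
    and "\<And>c t. Q t \<Longrightarrow> Q (c *\<^sub>R t)"
  shows "Q t"
proof (rule span_induct_alt[OF tensor_in_span_pure[of t]])
  \<comment> \<open>Scaling a pure tensor by 0 supplies the zero tensor that the span induction asks
    for.\<close>
  show "Q 0" using assms(3)[of "pure_tensor []" 0] assms(1) by simp
qed (use assms in auto)

text \<open>The supports of \<open>p\<close>, \<open>q\<close> and \<open>p + q\<close> differ, so
  all sums are compared over one finite superset, where the extra coefficients are zero.\<close>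

lemma linear_tensor_lift:
  assumes f: "multilinear f"
  shows "linear (tensor_lift f)"
proof -
  have superset: "tensor_lift f (abs_tensor p) = (\<Sum>xs\<in>A. Poly_Mapping.lookup p xs *\<^sub>R f xs)"
    if "finite A" "Poly_Mapping.keys p \<subseteq> A" for p A
    unfolding tensor_lift_abs[OF f] using that
    by (intro sum.mono_neutral_left) (auto simp: in_keys_iff)
  show ?thesis
  proof (rule linearI)
    fix s t :: "'a tensor" and c :: real
    obtain p where p: "s = abs_tensor p" by (metis Quotient3_abs_rep[OF Quotient3_tensor])
    obtain q where q: "t = abs_tensor q" by (metis Quotient3_abs_rep[OF Quotient3_tensor])
    note pq = p q
    let ?A = "Poly_Mapping.keys p \<union> Poly_Mapping.keys q"
    have "Poly_Mapping.keys (p + q) \<subseteq> ?A" by (rule Poly_Mapping.keys_add)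
    then show "tensor_lift f (s + t) = tensor_lift f s + tensor_lift f t"
      by (simp add: pq plus_tensor.abs_eq superset[of ?A] lookup_add scaleR_add_left sum.distrib)
    have "Poly_Mapping.keys (c *\<^sub>R p) \<subseteq> Poly_Mapping.keys p"
      by (auto simp: in_keys_iff)
    then show "tensor_lift f (c *\<^sub>R s) = c *\<^sub>R tensor_lift f s"
      by (simp add: pq scaleR_tensor.abs_eq superset[of "Poly_Mapping.keys p"] scaleR_sum_right)
  qed
qed

text \<open>Since pure tensors span, identities between linear maps on tensors reduce to identities
  about lists.\<close>

lemma linear_tensor_eqI:
  assumes "linear f" "linear g" "\<And>xs. f (pure_tensor xs) = g (pure_tensor xs)"
  shows "f t = g t"
  by (induction t rule: tensor_induct)
    (simp_all add: assms linear_add[of f] linear_add[of g] linear_scale[of f] linear_scale[of g])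

text \<open>This allows recursion on the list of factors: an empty prefix \<open>us\<close> concerns
  the head slot, a nonempty one the slots behind a fixed head.\<close>

lemma multilinear_ConsI:
  assumes "\<And>vs. linear (\<lambda>x. F (x # vs))" and "\<And>u. multilinear (\<lambda>xs. F (u # xs))"
  shows "multilinear F"
  unfolding multilinear_def
proof (intro allI)
  fix us vs
  show "linear (\<lambda>x. F (us @ x # vs))"
    using assms by (cases us) (auto simp: multilinear_def)
qed

lemma multilinear_zero: "multilinear (\<lambda>xs. 0)"
  by (simp add: multilinear_def linear_zero)

lemma multilinear_compose:
  "multilinear f \<Longrightarrow> linear g \<Longrightarrow> multilinear (\<lambda>xs. g (f xs))"
  unfolding multilinear_def using linear_compose[unfolded o_def] by blast

text \<open>Nested lifts such as the one in \<open>tensor_concat\<close> require the inner lift to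
  be multilinear in the outer list. Induction on \<open>t\<close> reduces this to multilinearity of
  \<open>G\<close> in its first argument.\<close>

lemma multilinear_tensor_lift_param:
  assumes "\<And>xs. multilinear (G xs)" "\<And>ys. multilinear (\<lambda>xs. G xs ys)"
  shows "multilinear (\<lambda>xs. tensor_lift (G xs) t)"
proof (induction t rule: tensor_induct)
  case (pure ys)
  show ?case using assms by (simp add: tensor_lift_pure)
next
  case (add s t)
  then show ?case
    by (simp add: linear_add[OF linear_tensor_lift[OF assms(1)]] multilinear_def linear_compose_add)
next
  case (scale c t)
  then show ?case
    by (simp add: linear_scale[OF linear_tensor_lift[OF assms(1)]] multilinear_def
        linear_compose_scale_right)
qed

lemma linear_tensor_lift_param:
  assumes "\<And>xs. multilinear (G xs)" "\<And>ys. multilinear (\<lambda>xs. G xs ys)"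
  shows "linear (\<lambda>t. tensor_lift (\<lambda>xs. tensor_lift (G xs) t) s)"
proof (induction s rule: tensor_induct)
  case (pure xs)
  show ?case
    using assms by (simp add: tensor_lift_pure multilinear_tensor_lift_param linear_tensor_lift)
next
  case (add s t)
  then show ?case
    by (simp add: linear_add[OF linear_tensor_lift[OF multilinear_tensor_lift_param[OF assms]]]
        linear_compose_add)
next
  case (scale c t)
  then show ?case
    by (simp add: linear_scale[OF linear_tensor_lift[OF multilinear_tensor_lift_param[OF assms]]]
        linear_compose_scale_right)
qed

section \<open>Concatenation of tensors and tensor products of maps\<close>

lemma multilinear_append_left: "multilinear (\<lambda>ys. pure_tensor (xs @ ys))"
  unfolding multilinear_def
  using multilinear_pure_tensor[unfolded multilinear_def, rule_format, of "xs @ _"] by simp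

lemma multilinear_append_right: "multilinear (\<lambda>xs. pure_tensor (xs @ ys))"
  unfolding multilinear_def
  using multilinear_pure_tensor[unfolded multilinear_def, rule_format, of _ "_ @ ys"] by simp

lemma tensor_concat_pure: "tensor_concat (pure_tensor xs) (pure_tensor ys) = pure_tensor (xs @ ys)"
  by (simp add: tensor_concat_def tensor_lift_pure multilinear_append_left multilinear_append_right
      multilinear_tensor_lift_param)

lemma linear_tensor_concat_left: "linear (\<lambda>s. tensor_concat s t)"
  unfolding tensor_concat_def
  by (intro linear_tensor_lift multilinear_tensor_lift_param multilinear_append_left
      multilinear_append_right)

lemma linear_tensor_concat_right: "linear (tensor_concat s)"
  unfolding tensor_concat_def[abs_def]
  by (intro linear_tensor_lift_param multilinear_append_left multilinear_append_right)

lemma linear_tensor_of: "linear tensor_of"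
  using multilinear_pure_tensor[unfolded multilinear_def, rule_format, of "[]" "[]"]
  by (simp add: tensor_of_def[abs_def])

text \<open>As \<open>tensor_concat\<close> is linear in each argument, each further map contributes
  one linear slot; lists of the wrong length give the zero map, which is linear too.\<close>

lemma multilinear_foldr_concat:
  assumes "\<forall>f\<in>set fs. linear f"
  shows "multilinear (\<lambda>xs. if length xs = length fs
     then foldr tensor_concat (map2 (\<lambda>f x. f x) fs xs) (pure_tensor []) else 0)"
  using assms
proof (induction fs)
  case Nil
  show ?case by (rule multilinear_ConsI) (simp_all add: linear_zero multilinear_zero)
next
  case (Cons f fs)
  let ?M = "\<lambda>xs. if length xs = length fs
     then foldr tensor_concat (map2 (\<lambda>f x. f x) fs xs) (pure_tensor []) else 0"
  have ml: "multilinear ?M" using Cons by simp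
  have lin: "linear f" using Cons by simp
  show ?case
  proof (rule multilinear_ConsI)
    fix vs
    show "linear (\<lambda>x. if length (x # vs) = length (f # fs)
      then foldr tensor_concat (map2 (\<lambda>f x. f x) (f # fs) (x # vs)) (pure_tensor []) else 0)"
      using linear_compose[OF lin linear_tensor_concat_left]
      by (cases "length vs = length fs") (simp_all add: o_def linear_zero)
  next
    fix u
    \<comment> \<open>\<open>tensor_concat (f u)\<close> sends 0 to 0, so the length test can move
      inside it.\<close>
    have "(if length (u # xs) = length (f # fs)
      then foldr tensor_concat (map2 (\<lambda>f x. f x) (f # fs) (u # xs)) (pure_tensor []) else 0)
      = tensor_concat (f u) (?M xs)" for xs
      by (simp add: linear_0[OF linear_tensor_concat_right])
    then show "multilinear (\<lambda>xs. if length (u # xs) = length (f # fs)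
      then foldr tensor_concat (map2 (\<lambda>f x. f x) (f # fs) (u # xs)) (pure_tensor []) else 0)"
      by (simp only: multilinear_compose[OF ml linear_tensor_concat_right])
  qed
qed

lemma linear_tensor_maps: "\<forall>f\<in>set fs. linear f \<Longrightarrow> linear (tensor_maps fs)"
  unfolding tensor_maps_def by (intro linear_tensor_lift multilinear_foldr_concat)

lemma tensor_maps_pure:
  "\<forall>f\<in>set fs. linear f \<Longrightarrow> tensor_maps fs (pure_tensor xs) = (if length xs = length fs
     then foldr tensor_concat (map2 (\<lambda>f x. f x) fs xs) (pure_tensor []) else 0)"
  unfolding tensor_maps_def by (simp add: tensor_lift_pure multilinear_foldr_concat)

lemma foldr_concat_tensor_of:
  "foldr tensor_concat (map2 (\<lambda>f x. f x) (map ((\<circ>) tensor_of) fs) xs) (pure_tensor [])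
     = pure_tensor (map2 (\<lambda>f x. f x) fs xs)"
proof (induction fs arbitrary: xs)
  case (Cons f fs)
  then show ?case by (cases xs) (simp_all add: tensor_of_def tensor_concat_pure)
qed simp

text \<open>One formula for the projections in \<open>coprod_comp\<close>, the decorations in
  \<open>mult_comult\<close> and the maps in the definition of coalgebra morphisms.\<close>

lemma tensor_maps_of_pure:
  assumes "\<forall>f\<in>set fs. linear f"
  shows "tensor_maps (map ((\<circ>) tensor_of) fs) (pure_tensor xs) =
    (if length xs = length fs then pure_tensor (map2 (\<lambda>f x. f x) fs xs) else 0)"
proof -
  have "\<forall>f\<in>set (map ((\<circ>) tensor_of) fs). linear f"
    using assms linear_compose[OF _ linear_tensor_of] by auto
  from tensor_maps_pure[OF this] show ?thesis by (simp add: foldr_concat_tensor_of)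
qed

lemma linear_tensor_maps_of:
  "\<forall>f\<in>set fs. linear f \<Longrightarrow> linear (tensor_maps (map ((\<circ>) tensor_of) fs))"
  using linear_compose[OF _ linear_tensor_of] by (intro linear_tensor_maps) auto

section \<open>Tensor products of functionals\<close>

definition tensor_eval :: "('a::real_vector \<Rightarrow> real) list \<Rightarrow> 'a tensor \<Rightarrow> real" where
  "tensor_eval \<phi>s = tensor_lift (\<lambda>xs.
     if length xs = length \<phi>s then prod_list (map2 (\<lambda>f x. f x) \<phi>s xs) else 0)"

text \<open>With this, \<open>tensor_eval \<phi>s\<close> is the tensor product of the functionals
  in \<open>\<phi>s\<close>, extended by zero to all other tensor powers. The head functional
  contributes a scalar factor to the functional of the tail.\<close>

lemma multilinear_prod_eval:
  fixes \<phi>s :: "('a::real_vector \<Rightarrow> real) list"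
  assumes "\<forall>f\<in>set \<phi>s. linear f"
  shows "multilinear (\<lambda>xs.
     if length xs = length \<phi>s then prod_list (map2 (\<lambda>f x. f x) \<phi>s xs) else 0)"
  using assms
proof (induction \<phi>s)
  case Nil
  show ?case by (rule multilinear_ConsI) (simp_all add: linear_zero multilinear_zero)
next
  case (Cons f fs)
  let ?M = "\<lambda>xs. if length xs = length fs then prod_list (map2 (\<lambda>f x. f x) fs xs) else 0"
  have ml: "multilinear ?M" using Cons by simp
  have lin: "linear f" using Cons by simp
  show ?case
  proof (rule multilinear_ConsI)
    fix vs
    show "linear (\<lambda>x. if length (x # vs) = length (f # fs)
      then prod_list (map2 (\<lambda>f x. f x) (f # fs) (x # vs)) else 0)"
      using linear_compose_scale_right[OF lin, of "prod_list (map2 (\<lambda>f x. f x) fs vs)"]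
      by (cases "length vs = length fs") (simp_all add: mult.commute linear_zero)
  next
    fix u
    have "(if length (u # xs) = length (f # fs)
      then prod_list (map2 (\<lambda>f x. f x) (f # fs) (u # xs)) else 0) = f u *\<^sub>R ?M xs" for xs
      by simp
    then show "multilinear (\<lambda>xs. if length (u # xs) = length (f # fs)
      then prod_list (map2 (\<lambda>f x. f x) (f # fs) (u # xs)) else 0)"
      by (simp only: multilinear_compose[OF ml linear_compose_scale_right[OF linear_id, unfolded id_def]])
  qed
qed

lemma linear_tensor_eval: "\<forall>f\<in>set \<phi>s. linear f \<Longrightarrow> linear (tensor_eval \<phi>s)"
  unfolding tensor_eval_def by (intro linear_tensor_lift multilinear_prod_eval)

lemma tensor_eval_pure:
  "\<forall>f\<in>set \<phi>s. linear f \<Longrightarrow> tensor_eval \<phi>s (pure_tensor xs) =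
     (if length xs = length \<phi>s then prod_list (map2 (\<lambda>f x. f x) \<phi>s xs) else 0)"
  unfolding tensor_eval_def by (simp add: tensor_lift_pure multilinear_prod_eval)

lemma multilinear_prod_list: "multilinear (prod_list :: 'a::real_algebra_1 list \<Rightarrow> 'a)"
  unfolding multilinear_def by (intro allI linearI) (simp_all add: algebra_simps)

lemma linear_tensor_mult: "linear tensor_mult"
  unfolding tensor_mult_def by (intro linear_tensor_lift multilinear_prod_list)

lemma tensor_mult_pure: "tensor_mult (pure_tensor xs) = prod_list xs"
  unfolding tensor_mult_def by (simp add: tensor_lift_pure multilinear_prod_list)

lemma multilinear_rev: "multilinear (\<lambda>xs. pure_tensor (rev xs))"
  unfolding multilinear_def
proof (intro allI)
  fix us vs :: "'a list"
  show "linear (\<lambda>x. pure_tensor (rev (us @ x # vs)))"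
    using multilinear_pure_tensor[unfolded multilinear_def, rule_format, of "rev vs" "rev us"] by simp
qed

lemma linear_tensor_rev: "linear tensor_rev"
  unfolding tensor_rev_def by (intro linear_tensor_lift multilinear_rev)

lemma tensor_rev_pure: "tensor_rev (pure_tensor xs) = pure_tensor (rev xs)"
  unfolding tensor_rev_def by (simp add: tensor_lift_pure multilinear_rev)

text \<open>For fixed \<open>xs\<close> the entrywise product is a tensor product of left
  multiplications applied to \<open>ys\<close>, so it inherits multilinearity from
  \<open>pure_tensor\<close>.\<close>

lemma multilinear_times_right:
  fixes xs :: "'a::real_algebra list"
  shows "multilinear (\<lambda>ys. if length xs = length ys then pure_tensor (map2 (*) xs ys) else 0)"
proof -
  have lin: "\<forall>f\<in>set (map (*) xs). linear f"
    by (auto intro!: linearI simp: algebra_simps)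
  have "(if length xs = length ys then pure_tensor (map2 (*) xs ys) else 0)
      = tensor_maps (map ((\<circ>) tensor_of) (map (*) xs)) (pure_tensor ys)" for ys
    unfolding tensor_maps_of_pure[OF lin] by (auto simp: map2_map_map zip_map1 split_def o_def)
  then show ?thesis
    by (simp only: multilinear_compose[OF multilinear_pure_tensor linear_tensor_maps_of[OF lin]])
qed

lemma multilinear_times_left:
  fixes ys :: "'a::real_algebra list"
  shows "multilinear (\<lambda>xs. if length xs = length ys then pure_tensor (map2 (*) xs ys) else 0)"
proof -
  have lin: "\<forall>f\<in>set (map (\<lambda>y x. x * y) ys). linear f"
    by (auto intro!: linearI simp: algebra_simps)
  have eq: "map2 (*) xs ys = map2 (\<lambda>f x. f x) (map (\<lambda>y x. x * y) ys) xs" for xs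
    by (simp add: list_eq_iff_nth_eq)
  have "(if length xs = length ys then pure_tensor (map2 (*) xs ys) else 0)
      = tensor_maps (map ((\<circ>) tensor_of) (map (\<lambda>y x. x * y) ys)) (pure_tensor xs)" for xs
    unfolding tensor_maps_of_pure[OF lin] eq by simp
  then show ?thesis
    by (simp only: multilinear_compose[OF multilinear_pure_tensor linear_tensor_maps_of[OF lin]])
qed

lemma tensor_times_pure:
  "tensor_times (pure_tensor xs) (pure_tensor ys)
     = (if length xs = length ys then pure_tensor (map2 (*) xs ys) else 0)"
  unfolding tensor_times_def
  by (subst tensor_lift_pure, intro multilinear_tensor_lift_param multilinear_times_right
      multilinear_times_left) (rule tensor_lift_pure[OF multilinear_times_right])

lemma linear_tensor_times_left: "linear (\<lambda>s. tensor_times s t)"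
  unfolding tensor_times_def
  by (intro linear_tensor_lift multilinear_tensor_lift_param multilinear_times_left
      multilinear_times_right)

lemma linear_tensor_times_right: "linear (tensor_times s)"
  unfolding tensor_times_def[abs_def]
  by (intro linear_tensor_lift_param multilinear_times_left multilinear_times_right)

text \<open>A functional that splits products into finite sums does the same on the tensor square;
  this later combines the Leibniz rule for \<open>zeta\<close> with the binomial rule for a lower
  power. Both sides are bilinear in \<open>s\<close> and \<open>t\<close> and vanish on pure tensors
  unless both lists have length two.\<close>

lemma tensor_eval_times:
  fixes \<phi> \<psi> :: "'a::real_algebra \<Rightarrow> real"
  assumes "linear \<phi>" "linear \<psi>"
    and lin: "\<And>i. linear (\<phi>1 i)" "\<And>i. linear (\<phi>2 i)" "\<And>j. linear (\<psi>1 j)" "\<And>j. linear (\<psi>2 j)"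
    and \<phi>: "\<And>a b. \<phi> (a * b) = (\<Sum>i\<in>I. \<phi>1 i a * \<phi>2 i b)"
    and \<psi>: "\<And>a b. \<psi> (a * b) = (\<Sum>j\<in>J. \<psi>1 j a * \<psi>2 j b)"
  shows "tensor_eval [\<phi>, \<psi>] (tensor_times s t)
    = (\<Sum>i\<in>I. \<Sum>j\<in>J. tensor_eval [\<phi>1 i, \<psi>1 j] s * tensor_eval [\<phi>2 i, \<psi>2 j] t)" (is "?L s t = ?R s t")
proof -
  have L: "linear (tensor_eval [\<phi>, \<psi>])"
    using assms by (simp add: linear_tensor_eval)
  have l1: "linear (tensor_eval [\<phi>1 i, \<psi>1 j])" and l2: "linear (tensor_eval [\<phi>2 i, \<psi>2 j])" for i j
    using lin by (simp_all add: linear_tensor_eval)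
  have lin2: "linear (?L s)" "linear (?R s)" for s
    subgoal using linear_compose[OF linear_tensor_times_right L] by (simp add: o_def)
    subgoal by (intro linear_compose_sum linear_compose_scale_right[where 'b=real, simplified] ballI l2)
    done
  have lin1: "linear (\<lambda>s. ?L s t)" "linear (\<lambda>s. ?R s t)" for t
    subgoal using linear_compose[OF linear_tensor_times_left L] by (simp add: o_def)
    subgoal unfolding mult.commute[of "tensor_eval _ _" "tensor_eval _ t"]
      by (intro linear_compose_sum linear_compose_scale_right[where 'b=real, simplified] ballI l1)
    done
  have "?L (pure_tensor xs) (pure_tensor ys) = ?R (pure_tensor xs) (pure_tensor ys)" for xs ys
  proof (cases "length xs = 2 \<and> length ys = 2")
    case True
    then obtain a b c d where xs: "xs = [a, b]" and ys: "ys = [c, d]"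
      by (auto simp: length_Suc_conv numeral_2_eq_2)
    show ?thesis
      unfolding xs ys using assms(1,2) lin
      by (simp add: tensor_times_pure tensor_eval_pure \<phi> \<psi> sum_product mult_ac)
  next
    case False
    then show ?thesis
      using assms(1,2) lin linear_0[OF L] by (auto simp: tensor_times_pure tensor_eval_pure)
  qed
  then have "?L (pure_tensor xs) t = ?R (pure_tensor xs) t" for xs
    by (rule linear_tensor_eqI[OF lin2])
  then show ?thesis
    by (rule linear_tensor_eqI[OF lin1])
qed

text \<open>Moves projections or a coalgebra map from the tensor onto the functionals.\<close>

lemma tensor_eval_maps_of:
  assumes "\<forall>f\<in>set fs. linear f" "\<forall>\<phi>\<in>set \<phi>s. linear \<phi>" "length \<phi>s = length fs"
  shows "tensor_eval \<phi>s (tensor_maps (map ((\<circ>) tensor_of) fs) t) = tensor_eval (map2 (\<circ>) \<phi>s fs) t"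
proof (rule linear_tensor_eqI[where f = "\<lambda>t. tensor_eval \<phi>s (tensor_maps (map ((\<circ>) tensor_of) fs) t)"])
  have lin: "\<forall>\<phi>\<in>set (map2 (\<circ>) \<phi>s fs). linear \<phi>"
    using assms(1,2) by (auto dest!: set_zip_leftD set_zip_rightD intro: linear_compose
        elim!: in_set_zipE)
  show "linear (\<lambda>t. tensor_eval \<phi>s (tensor_maps (map ((\<circ>) tensor_of) fs) t))"
    using linear_compose[OF linear_tensor_maps_of linear_tensor_eval, OF assms(1,2)]
    by (simp add: o_def)
  show "linear (tensor_eval (map2 (\<circ>) \<phi>s fs))"
    using lin by (rule linear_tensor_eval)
  fix xs
  have "map2 (\<lambda>f x. f x) \<phi>s (map2 (\<lambda>f x. f x) fs xs) = map2 (\<lambda>f x. f x) (map2 (\<circ>) \<phi>s fs) xs"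
    by (simp add: list_eq_iff_nth_eq)
  then show "tensor_eval \<phi>s (tensor_maps (map ((\<circ>) tensor_of) fs) (pure_tensor xs))
      = tensor_eval (map2 (\<circ>) \<phi>s fs) (pure_tensor xs)"
    using assms linear_0[OF linear_tensor_eval, OF assms(2)]
    by (simp add: tensor_maps_of_pure tensor_eval_pure[OF lin] tensor_eval_pure[OF assms(2)])
qed

text \<open>Fixing the tensor power of \<open>s\<close> pins down where the concatenation is cut. A
  list of the right total length but cut elsewhere could count on the left and not on the
  right.\<close>

lemma tensor_eval_concat:
  assumes "\<forall>\<phi>\<in>set (\<phi>s @ \<psi>s). linear \<phi>" "s \<in> span {pure_tensor xs |xs. length xs = length \<phi>s}"
  shows "tensor_eval (\<phi>s @ \<psi>s) (tensor_concat s t) = tensor_eval \<phi>s s * tensor_eval \<psi>s t"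
proof -
  have lin: "linear (tensor_eval (\<phi>s @ \<psi>s))" "linear (tensor_eval \<phi>s)" "linear (tensor_eval \<psi>s)"
    using assms(1) by (auto intro!: linear_tensor_eval)
  show ?thesis
    using assms(2)
  proof (induction rule: span_induct_alt)
    case base
    show ?case by (simp add: lin linear_0 linear_0[OF linear_tensor_concat_left])
  next
    case (step c x s)
    then obtain xs where x: "x = pure_tensor xs" and len: "length xs = length \<phi>s" by auto
    have "tensor_eval (\<phi>s @ \<psi>s) (tensor_concat x t) = tensor_eval \<phi>s x * tensor_eval \<psi>s t"
    proof (rule linear_tensor_eqI)
      show "linear (\<lambda>t. tensor_eval (\<phi>s @ \<psi>s) (tensor_concat x t))"
        using linear_compose[OF linear_tensor_concat_right lin(1)] by (simp add: o_def)
      show "linear (\<lambda>t. tensor_eval \<phi>s x * tensor_eval \<psi>s t)"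
        using linear_compose_scale_right[OF lin(3)] by simp
      fix ys
      show "tensor_eval (\<phi>s @ \<psi>s) (tensor_concat x (pure_tensor ys))
          = tensor_eval \<phi>s x * tensor_eval \<psi>s (pure_tensor ys)"
        using assms(1) len by (simp add: x tensor_concat_pure tensor_eval_pure)
    qed
    with step show ?case
      by (simp add: linear_add[OF linear_tensor_concat_left] linear_scale[OF linear_tensor_concat_left]
          linear_add[OF lin(1)] linear_scale[OF lin(1)] linear_add[OF lin(2)] linear_scale[OF lin(2)]
          algebra_simps)
  qed
qed

lemma linear_image_in_span:
  assumes "linear f" "v \<in> span S" "\<And>s. s \<in> S \<Longrightarrow> f s \<in> span T"
  shows "f v \<in> span T"
proof -
  have "f v \<in> span (f ` S)"
    using assms(1,2) by (simp add: linear_span_image)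
  also have "\<dots> \<subseteq> span T"
    using assms(3) by (intro span_minimal subspace_span) auto
  finally show ?thesis .
qed

section \<open>Bases of tensor powers\<close>

lemma finite_listset: "\<forall>A\<in>set As. finite A \<Longrightarrow> finite (listset As)"
  by (induction As) (auto simp: set_Cons_def finite_image_set2)

lemma in_listset_iff: "xs \<in> listset As \<longleftrightarrow> list_all2 (\<in>) xs As"
  by (induction As arbitrary: xs) (auto simp: set_Cons_def list_all2_Cons2)

text \<open>Factors are expanded one at a time: the tail by linearity of
  \<open>tensor_concat\<close> on the right, the head by linearity on the left.\<close>

lemma pure_tensor_in_span_listset:
  "list_all2 (\<lambda>x A. x \<in> span A) xs As \<Longrightarrow> pure_tensor xs \<in> span (pure_tensor ` listset As)"
proof (induction rule: list_all2_induct)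
  case Nil
  show ?case by (simp add: span_base)
next
  case (Cons x xs A As)
  have "tensor_concat (tensor_of x) (pure_tensor xs) \<in> span (pure_tensor ` listset (A # As))"
  proof (rule linear_image_in_span[OF linear_tensor_concat_right Cons.IH])
    fix s assume "s \<in> pure_tensor ` listset As"
    then obtain zs where zs: "zs \<in> listset As" "s = pure_tensor zs" by auto
    show "tensor_concat (tensor_of x) s \<in> span (pure_tensor ` listset (A # As))"
    proof (rule linear_image_in_span[OF linear_compose[OF linear_tensor_of linear_tensor_concat_left],
          unfolded o_def])
      show "x \<in> span A" by fact
      fix a assume "a \<in> A"
      with zs show "tensor_concat (tensor_of a) s \<in> span (pure_tensor ` listset (A # As))"
        by (intro span_base) (auto simp: tensor_of_def tensor_concat_pure set_Cons_def)
    qed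
  qed
  then show ?case by (simp add: tensor_of_def tensor_concat_pure)
qed

lemma linear_representation:
  "independent S \<Longrightarrow> span S = UNIV \<Longrightarrow> linear (\<lambda>v. representation S v b)"
  by (rule linearI) (simp_all add: representation_add representation_scale)

text \<open>Products of coordinate functionals are dual to pure tensors of basis vectors.
  Injectivity and independence below both follow by evaluating such a product.\<close>

lemma tensor_eval_representation:
  assumes S: "independent S" "span S = UNIV" and "set xs \<subseteq> S" "set zs \<subseteq> S"
  shows "tensor_eval (map (\<lambda>b v. representation S v b) zs) (pure_tensor xs) = (if xs = zs then 1 else 0)"
proof -
  have lin: "\<forall>f\<in>set (map (\<lambda>b v. representation S v b) zs). linear f"
    using linear_representation[OF S] by auto
  have "(if length xs = length zs
      then prod_list (map2 (\<lambda>f x. f x) (map (\<lambda>b v. representation S v b) zs) xs) else 0)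
      = (if xs = zs then 1 else (0::real))"
    using assms(3,4)
  proof (induction zs arbitrary: xs)
    case (Cons z zs)
    show ?case
    proof (cases xs)
      case Nil
      then show ?thesis by simp
    next
      case (Cons x xs')
      with Cons.prems show ?thesis
        using Cons.IH[of xs'] by (auto simp: representation_basis[OF S(1)])
    qed
  qed auto
  then show ?thesis by (simp add: tensor_eval_pure[OF lin])
qed

lemma inj_on_pure_tensor:
  assumes S: "independent S" "span S = UNIV"
  shows "inj_on pure_tensor (lists S)"
proof (rule inj_onI)
  fix xs ys assume xy: "xs \<in> lists S" "ys \<in> lists S" "pure_tensor xs = pure_tensor ys"
  then show "xs = ys"
    using tensor_eval_representation[OF S, of xs ys] tensor_eval_representation[OF S, of ys ys]
    by (auto simp: subset_eq split: if_splits)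
qed

text \<open>The dual functional of \<open>zs\<close> kills the other pure tensors of the family,
  hence their span, but is 1 at \<open>zs\<close> itself.\<close>

lemma independent_pure_tensor:
  assumes S: "independent S" "span S = UNIV" and L: "L \<subseteq> lists S"
  shows "independent (pure_tensor ` L)"
  unfolding dependent_def
proof (intro notI, elim bexE)
  fix t assume t: "t \<in> pure_tensor ` L" "t \<in> span (pure_tensor ` L - {t})"
  then obtain zs where zs: "t = pure_tensor zs" "zs \<in> L" by auto
  let ?f = "tensor_eval (map (\<lambda>b v. representation S v b) zs)"
  have "linear ?f"
    using linear_representation[OF S] by (intro linear_tensor_eval) auto
  moreover have "?f s = 0" if "s \<in> pure_tensor ` L - {t}" for s
  proof -
    from that zs obtain xs where "s = pure_tensor xs" "xs \<in> L" "xs \<noteq> zs" by auto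
    then show ?thesis
      using tensor_eval_representation[OF S, of xs zs] L zs by (auto simp: subset_eq)
  qed
  ultimately have "?f t = 0"
    using t(2) by (rule linear_eq_0_on_span)
  moreover have "?f t = 1"
    using tensor_eval_representation[OF S, of zs zs] L zs by (auto simp: subset_eq)
  ultimately show False by simp
qed

section \<open>Functionals evaluated on two-fold tensor maps\<close>

lemma tensor_concat_Nil_right: "tensor_concat t (pure_tensor []) = t"
  by (rule linear_tensor_eqI[OF linear_tensor_concat_left linear_id[unfolded id_def]])
    (simp add: tensor_concat_pure)

text \<open>Turns the coalgebra axioms, which are equations between two-fold
  \<open>tensor_maps\<close>, into laws for convolution. The range condition on \<open>f\<close>
  locates the cut between the two blocks, as in \<open>tensor_eval_concat\<close>.\<close>

lemma tensor_eval_maps_pair: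
  assumes f: "linear f" and g: "linear g"
    and \<phi>s: "\<forall>\<phi>\<in>set \<phi>s. linear \<phi>" and \<psi>s: "\<forall>\<psi>\<in>set \<psi>s. linear \<psi>"
    and range: "\<And>x. f x \<in> span {pure_tensor xs |xs. length xs = length \<phi>s}"
  shows "tensor_eval (\<phi>s @ \<psi>s) (tensor_maps [f, g] t)
    = tensor_eval [\<lambda>x. tensor_eval \<phi>s (f x), \<lambda>x. tensor_eval \<psi>s (g x)] t"
proof (rule linear_tensor_eqI)
  have lin: "linear (tensor_eval (\<phi>s @ \<psi>s))" "linear (tensor_eval \<phi>s)" "linear (tensor_eval \<psi>s)"
    using \<phi>s \<psi>s by (auto intro!: linear_tensor_eval)
  have fg: "\<forall>h\<in>set [f, g]. linear h" using f g by simp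
  show "linear (\<lambda>t. tensor_eval (\<phi>s @ \<psi>s) (tensor_maps [f, g] t))"
    using linear_compose[OF linear_tensor_maps[OF fg] lin(1)] by (simp add: o_def)
  have pair: "\<forall>h\<in>set [\<lambda>x. tensor_eval \<phi>s (f x), \<lambda>x. tensor_eval \<psi>s (g x)]. linear h"
    using linear_compose[OF f lin(2)] linear_compose[OF g lin(3)] by (simp add: o_def)
  then show "linear (tensor_eval [\<lambda>x. tensor_eval \<phi>s (f x), \<lambda>x. tensor_eval \<psi>s (g x)])"
    by (rule linear_tensor_eval)
  fix xs :: "'a list"
  show "tensor_eval (\<phi>s @ \<psi>s) (tensor_maps [f, g] (pure_tensor xs))
    = tensor_eval [\<lambda>x. tensor_eval \<phi>s (f x), \<lambda>x. tensor_eval \<psi>s (g x)] (pure_tensor xs)"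
  proof (cases "length xs = 2")
    case True
    then obtain a b where xs: "xs = [a, b]"
      by (auto simp: length_Suc_conv numeral_2_eq_2)
    show ?thesis
      using \<phi>s \<psi>s tensor_eval_concat[OF _ range, of \<psi>s a "g b"]
      by (simp add: tensor_eval_pure[OF pair] tensor_maps_pure[OF fg] xs tensor_concat_Nil_right ball_Un)
  next
    case False
    then show ?thesis
      by (simp add: tensor_eval_pure[OF pair] tensor_maps_pure[OF fg] linear_0[OF lin(1)])
  qed
qed

lemma tensor_eval_tensor_of: "linear \<phi> \<Longrightarrow> tensor_eval [\<phi>] (tensor_of x) = \<phi> x"
  by (simp add: tensor_of_def tensor_eval_pure)

lemma tensor_of_in_span: "tensor_of x \<in> span {pure_tensor xs |xs. length xs = Suc 0}"
  by (rule span_base) (auto simp: tensor_of_def)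

lemma linear_scalar_tensor: "linear \<epsilon> \<Longrightarrow> linear (scalar_tensor \<epsilon>)"
  unfolding scalar_tensor_def[abs_def]
  by (rule linearI) (simp_all add: linear_add linear_scale scaleR_add_left)

lemma tensor_eval_scalar_tensor: "linear \<epsilon> \<Longrightarrow> tensor_eval [] (scalar_tensor \<epsilon> x) = \<epsilon> x"
  by (simp add: scalar_tensor_def linear_scale[OF linear_tensor_eval] tensor_eval_pure)

lemma scalar_tensor_in_span: "scalar_tensor \<epsilon> x \<in> span {pure_tensor []}"
  by (simp add: scalar_tensor_def span_scale span_base)

section \<open>Convolution powers of the degree-one functional\<close>

locale based_hopf_algebra = graded_connected_hopf_algebra H \<Delta> \<epsilon>
  for H :: "nat \<Rightarrow> 'h::real_algebra_1 set" and \<Delta> \<epsilon> +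
  fixes B :: "nat \<Rightarrow> 'h set"
  assumes finite_basis: "finite (B k)"
    and independent_basis: "independent (B k)"
    and span_basis: "span (B k) = H k"
    and basis_0: "B 0 = {1}"
begin

section \<open>The convolution algebra of linear functionals\<close>

definition conv :: "('h \<Rightarrow> real) \<Rightarrow> ('h \<Rightarrow> real) \<Rightarrow> 'h \<Rightarrow> real" where
  "conv \<phi> \<psi> x = tensor_eval [\<phi>, \<psi>] (\<Delta> x)"

lemma linear_conv: "linear \<phi> \<Longrightarrow> linear \<psi> \<Longrightarrow> linear (conv \<phi> \<psi>)"
  unfolding conv_def[abs_def]
  using linear_compose[OF coprod_linear linear_tensor_eval, of "[\<phi>, \<psi>]"] by (simp add: o_def)

lemma in_span_graded: "x \<in> span (\<Union>n. H n)"
  using graded by (simp add: graded_vector_space_def)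

text \<open>\<open>\<Delta>\<close> is typed into the full tensor algebra; its grading axiom
  confines it to the tensor square. This is the range condition for evaluating
  coassociativity.\<close>

lemma coprod_in_span: "\<Delta> x \<in> span {pure_tensor xs |xs. length xs = Suc (Suc 0)}"
proof (rule linear_image_in_span[OF coprod_linear in_span_graded])
  fix s assume "s \<in> (\<Union>n. H n)"
  then obtain n where "s \<in> H n" by auto
  from coprod_graded[OF this]
  have "\<Delta> s \<in> span (\<Union>i\<le>n. {pure_tensor [u, v] |u v. u \<in> H i \<and> v \<in> H (n - i)})" .
  also have "\<dots> \<subseteq> span {pure_tensor xs |xs. length xs = Suc (Suc 0)}"
    by (rule span_mono) auto
  finally show "\<Delta> s \<in> span {pure_tensor xs |xs. length xs = Suc (Suc 0)}" .
qed

text \<open>Coassociativity evaluated at the three functionals.\<close>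

lemma conv_assoc:
  assumes lin: "linear \<phi>" "linear \<psi>" "linear \<theta>"
  shows "conv (conv \<phi> \<psi>) \<theta> = conv \<phi> (conv \<psi> \<theta>)"
proof
  fix x
  have "conv (conv \<phi> \<psi>) \<theta> x = tensor_eval ([\<phi>, \<psi>] @ [\<theta>]) (tensor_maps [\<Delta>, tensor_of] (\<Delta> x))"
    using lin coprod_in_span
    by (subst tensor_eval_maps_pair)
      (simp_all add: coprod_linear linear_tensor_of tensor_eval_tensor_of conv_def[abs_def])
  also have "\<dots> = tensor_eval ([\<phi>] @ [\<psi>, \<theta>]) (tensor_maps [tensor_of, \<Delta>] (\<Delta> x))"
    by (simp add: coassoc)
  also have "\<dots> = conv \<phi> (conv \<psi> \<theta>) x"
    using lin tensor_of_in_span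
    by (subst tensor_eval_maps_pair)
      (simp_all add: coprod_linear linear_tensor_of tensor_eval_tensor_of conv_def[abs_def])
  finally show "conv (conv \<phi> \<psi>) \<theta> x = conv \<phi> (conv \<psi> \<theta>) x" .
qed

text \<open>The counit axiom is evaluated with an empty first block of functionals, since
  \<open>scalar_tensor \<epsilon>\<close> takes values in the zeroth tensor power.\<close>

lemma conv_counit_left:
  assumes "linear \<phi>"
  shows "conv \<epsilon> \<phi> = \<phi>"
proof
  fix x
  have "conv \<epsilon> \<phi> x = tensor_eval ([] @ [\<phi>]) (tensor_maps [scalar_tensor \<epsilon>, tensor_of] (\<Delta> x))"
    using assms scalar_tensor_in_span
    by (subst tensor_eval_maps_pair) (simp_all add: counit_linear linear_tensor_of
        linear_scalar_tensor tensor_eval_tensor_of tensor_eval_scalar_tensor conv_def)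
  then show "conv \<epsilon> \<phi> x = \<phi> x"
    by (simp add: counit_left assms tensor_eval_tensor_of)
qed

lemma conv_counit_right:
  assumes "linear \<phi>"
  shows "conv \<phi> \<epsilon> = \<phi>"
proof
  fix x
  have "conv \<phi> \<epsilon> x = tensor_eval ([\<phi>] @ []) (tensor_maps [tensor_of, scalar_tensor \<epsilon>] (\<Delta> x))"
    using assms tensor_of_in_span
    by (subst tensor_eval_maps_pair) (simp_all add: counit_linear linear_tensor_of
        linear_scalar_tensor tensor_eval_tensor_of tensor_eval_scalar_tensor conv_def)
  then show "conv \<phi> \<epsilon> x = \<phi> x"
    by (simp add: counit_right assms tensor_eval_tensor_of)
qed

lemma linear_iterated_coprod: "linear (iterated_coprod \<Delta> \<epsilon> l)"
proof (induction l rule: induct_nat_012)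
  case 0
  show ?case by (simp add: linear_scalar_tensor counit_linear)
next
  case 1
  show ?case by (simp add: linear_tensor_of)
next
  case (ge2 l)
  then show ?case
    using linear_compose[OF coprod_linear linear_tensor_maps,
        of "[tensor_of, iterated_coprod \<Delta> \<epsilon> (Suc l)]"]
    by (simp add: o_def linear_tensor_of)
qed

text \<open>Peeling the first factor off the iterated coproduct becomes one convolution on the dual
  side.\<close>

lemma tensor_eval_iterated_coprod:
  assumes "\<forall>\<phi>\<in>set \<phi>s. linear \<phi>"
  shows "tensor_eval \<phi>s (iterated_coprod \<Delta> \<epsilon> (length \<phi>s) x) = foldr conv \<phi>s \<epsilon> x"
  using assms
proof (induction \<phi>s arbitrary: x)
  case Nil
  show ?case by (simp add: tensor_eval_scalar_tensor counit_linear)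
next
  case (Cons \<phi> \<phi>s)
  show ?case
  proof (cases \<phi>s)
    case Nil
    \<comment> \<open>\<open>iterated_coprod\<close> has its own clause for one factor, so the final
      \<open>\<epsilon>\<close> of the fold is absorbed by the counit law.\<close>
    with Cons.prems show ?thesis by (simp add: tensor_eval_tensor_of conv_counit_right)
  next
    case (Cons \<psi> \<psi>s)
    let ?g = "iterated_coprod \<Delta> \<epsilon> (length \<phi>s)"
    have "tensor_eval (\<phi> # \<phi>s) (iterated_coprod \<Delta> \<epsilon> (length (\<phi> # \<phi>s)) x)
      = tensor_eval ([\<phi>] @ \<phi>s) (tensor_maps [tensor_of, ?g] (\<Delta> x))"
      using Cons by simp
    also have "\<dots> = tensor_eval [\<phi>, \<lambda>x. tensor_eval \<phi>s (?g x)] (\<Delta> x)"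
      using Cons.prems tensor_of_in_span
      by (subst tensor_eval_maps_pair)
        (simp_all add: linear_tensor_of linear_iterated_coprod tensor_eval_tensor_of)
    also have "\<dots> = foldr conv (\<phi> # \<phi>s) \<epsilon> x"
      using Cons.IH Cons.prems by (simp add: conv_def[of \<phi>])
    finally show ?thesis .
  qed
qed

section \<open>Homogeneous components and the union of the bases\<close>

lemma graded_proj_ex1: "\<exists>!u. u \<in> H n \<and> v - u \<in> span (\<Union>k\<in>- {n}. H k)"
proof -
  have sub: "subspace (H n)" and trivial: "H n \<inter> span (\<Union>k\<in>- {n}. H k) = {0}"
    using graded by (auto simp: graded_vector_space_def)
  have "(\<Union>k. H k) = H n \<union> (\<Union>k\<in>- {n}. H k)" by auto
  then have "v \<in> span (H n \<union> (\<Union>k\<in>- {n}. H k))"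
    using in_span_graded[of v] by simp
  then obtain u w where u: "u \<in> H n" "w \<in> span (\<Union>k\<in>- {n}. H k)" "v = u + w"
    unfolding span_Un span_eq_iff[THEN iffD2, OF sub] by auto
  show ?thesis
  proof (rule ex1I)
    show "u \<in> H n \<and> v - u \<in> span (\<Union>k\<in>- {n}. H k)" using u by simp
    fix u' assume u': "u' \<in> H n \<and> v - u' \<in> span (\<Union>k\<in>- {n}. H k)"
    \<comment> \<open>The difference of two candidates is homogeneous of degree \<open>n\<close> and
      also a combination of other degrees, so it is zero.\<close>
    have "u' - u \<in> H n" using u u' sub by (simp add: subspace_diff)
    moreover have "u' - u \<in> span (\<Union>k\<in>- {n}. H k)"
    proof -
      have "w - (v - u') \<in> span (\<Union>k\<in>- {n}. H k)"
        using u(2) conjunct2[OF u'] by (rule span_diff)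
      also have "w - (v - u') = u' - u"
        unfolding u(3) by (simp add: algebra_simps)
      finally show ?thesis .
    qed
    ultimately have "u' - u \<in> H n \<inter> span (\<Union>k\<in>- {n}. H k)"
      by (rule IntI)
    then have "u' - u = 0"
      unfolding trivial by (rule singletonD)
    then show "u' = u" by simp
  qed
qed

text \<open>\<open>graded_proj\<close> is a definite description; its properties rest on the unique
  existence given by the direct sum decomposition.\<close>

lemma graded_proj: "graded_proj H n v \<in> H n" "v - graded_proj H n v \<in> span (\<Union>k\<in>- {n}. H k)"
  using theI'[OF graded_proj_ex1[where n = n and v = v]] by (simp_all add: graded_proj_def)

lemma graded_proj_eqI:
  "u \<in> H n \<Longrightarrow> v - u \<in> span (\<Union>k\<in>- {n}. H k) \<Longrightarrow> graded_proj H n v = u"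
  using graded_proj_ex1[where n = n and v = v] graded_proj[where n = n and v = v] by auto

lemma subspace_H: "subspace (H n)"
  using graded by (simp add: graded_vector_space_def)

lemma linear_graded_proj: "linear (graded_proj H n)"
proof (rule linearI)
  fix v w :: 'h and c :: real
  have "(v - graded_proj H n v) + (w - graded_proj H n w) \<in> span (\<Union>k\<in>- {n}. H k)"
    by (intro span_add graded_proj)
  then show "graded_proj H n (v + w) = graded_proj H n v + graded_proj H n w"
    by (intro graded_proj_eqI) (simp_all add: subspace_add subspace_H graded_proj algebra_simps)
  have "c *\<^sub>R (v - graded_proj H n v) \<in> span (\<Union>k\<in>- {n}. H k)"
    by (intro span_scale graded_proj)
  then show "graded_proj H n (c *\<^sub>R v) = c *\<^sub>R graded_proj H n v"
    by (intro graded_proj_eqI) (simp_all add: subspace_scale subspace_H graded_proj algebra_simps)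
qed

text \<open>What the projection removes is a combination of other degrees, where
  \<open>\<phi>\<close> vanishes. Such functionals therefore absorb the projections inside
  \<open>coprod_comp\<close>.\<close>

lemma comp_graded_proj_eq:
  fixes \<phi> :: "'h \<Rightarrow> real"
  assumes \<phi>: "linear \<phi>" and zero: "\<And>m x. m \<noteq> n \<Longrightarrow> x \<in> H m \<Longrightarrow> \<phi> x = 0"
  shows "\<phi> \<circ> graded_proj H n = \<phi>"
proof
  fix v
  have "\<phi> (v - graded_proj H n v) = 0"
    using \<phi> _ graded_proj(2) by (rule linear_eq_0_on_span) (use zero in auto)
  then show "(\<phi> \<circ> graded_proj H n) v = \<phi> v" by (simp add: linear_diff[OF \<phi>])
qed

lemma span_Union_basis: "span (\<Union>n. B n) = UNIV"
proof -
  have "(\<Union>n. H n) \<subseteq> span (\<Union>n. B n)"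
    using span_basis span_mono[of "B _" "\<Union>n. B n"] by auto
  then have "span (\<Union>n. H n) \<subseteq> span (\<Union>n. B n)"
    by (rule span_minimal) (rule subspace_span)
  then show ?thesis using in_span_graded by auto
qed

lemma basis_in_H: "b \<in> B k \<Longrightarrow> b \<in> H k"
  using span_basis span_base by blast

text \<open>In a vanishing combination the part from \<open>B n\<close> equals minus the rest, so it
  lies in \<open>H n\<close> and in the span of the other degrees and is zero; then independence of
  \<open>B n\<close> applies.\<close>

lemma independent_Union_basis: "independent (\<Union>n. B n)"
  unfolding independent_explicit_finite_subsets
proof (intro allI impI ballI)
  fix A u b
  assume A: "A \<subseteq> (\<Union>n. B n)" "finite A" and sum0: "(\<Sum>v\<in>A. u v *\<^sub>R v) = 0" and b: "b \<in> A"
  from A b obtain n where n: "b \<in> B n" by auto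
  have "(\<Sum>v\<in>A. u v *\<^sub>R v) = (\<Sum>v\<in>A \<inter> B n. u v *\<^sub>R v) + (\<Sum>v\<in>A - B n. u v *\<^sub>R v)"
    using A by (subst sum.union_disjoint[symmetric]) (auto intro: sum.cong)
  then have eq: "(\<Sum>v\<in>A \<inter> B n. u v *\<^sub>R v) = - (\<Sum>v\<in>A - B n. u v *\<^sub>R v)"
    using sum0 by (simp add: eq_neg_iff_add_eq_0)
  have "(\<Sum>v\<in>A \<inter> B n. u v *\<^sub>R v) \<in> H n"
    by (intro subspace_sum subspace_scale subspace_H basis_in_H) auto
  moreover have "(\<Sum>v\<in>A \<inter> B n. u v *\<^sub>R v) \<in> span (\<Union>k\<in>- {n}. H k)"
    unfolding eq
  proof (intro span_neg span_sum span_scale span_base)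
    fix v assume "v \<in> A - B n"
    with A obtain k where "v \<in> B k" "k \<noteq> n" by auto
    then show "v \<in> (\<Union>k\<in>- {n}. H k)" using basis_in_H by auto
  qed
  ultimately have "(\<Sum>v\<in>A \<inter> B n. u v *\<^sub>R v) = 0"
    using graded by (auto simp: graded_vector_space_def)
  with independent_basis[of n] A b n show "u b = 0"
    unfolding independent_explicit_finite_subsets
    by (meson Int_iff Int_lower2 finite_Int)
qed

lemma basis_disjoint: "b \<in> B j \<Longrightarrow> b \<in> B k \<Longrightarrow> j = k"
proof (rule ccontr)
  assume b: "b \<in> B j" "b \<in> B k" and "j \<noteq> k"
  then have "b \<in> H j \<inter> span (\<Union>k\<in>- {j}. H k)"
    using basis_in_H by (auto intro!: span_base bexI[of _ k])
  then have "b = 0" using graded by (auto simp: graded_vector_space_def)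
  with b independent_basis show False using dependent_zero by blast
qed

lemma linear_eq_on_basis:
  assumes "linear f" "linear g" "\<And>k b. b \<in> B k \<Longrightarrow> f b = g b"
  shows "f = g"
proof
  fix x
  show "f x = g x"
    by (rule linear_eq_on_span[OF assms(1,2), of "\<Union>n. B n"]) (use assms(3) span_Union_basis in auto)
qed

section \<open>The degree-one functional, its Leibniz rule and its powers\<close>

definition zeta :: "'h \<Rightarrow> real" where
  "zeta = construct (\<Union>n. B n) (\<lambda>b. if b \<in> B 1 then 1 else 0)"

lemma linear_zeta: "linear zeta"
  unfolding zeta_def by (rule linear_construct[OF independent_Union_basis])

lemma zeta_basis: "b \<in> B k \<Longrightarrow> zeta b = (if k = 1 then 1 else 0)"
  unfolding zeta_def using basis_disjoint
  by (subst construct_basis[OF independent_Union_basis]) auto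

lemma zeta_graded: "x \<in> H m \<Longrightarrow> m \<noteq> 1 \<Longrightarrow> zeta x = 0"
  using linear_eq_0_on_span[OF linear_zeta, of "B m" x] by (simp add: zeta_basis span_basis)

text \<open>Both sides are bilinear, so basis elements suffice. A factor of degree 0 is 1; if both
  degrees are positive, the product has degree at least 2, where \<open>zeta\<close> vanishes, and
  both counits are 0.\<close>

lemma zeta_mult: "zeta (x * y) = \<epsilon> x * zeta y + zeta x * \<epsilon> y"
proof -
  let ?L = "\<lambda>x y. zeta (x * y)" and ?R = "\<lambda>x y. \<epsilon> x * zeta y + zeta x * \<epsilon> y"
  have lin_y: "linear (?L x)" "linear (?R x)" for x
    by (rule linearI; simp add: algebra_simps linear_add[OF linear_zeta] linear_scale[OF linear_zeta]
        linear_add[OF counit_linear] linear_scale[OF counit_linear])+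
  have lin_x: "linear (\<lambda>x. ?L x y)" "linear (\<lambda>x. ?R x y)" for y
    by (rule linearI; simp add: algebra_simps linear_add[OF linear_zeta] linear_scale[OF linear_zeta]
        linear_add[OF counit_linear] linear_scale[OF counit_linear])+
  have "?L a b = ?R a b" if a: "a \<in> B i" and b: "b \<in> B j" for a b i j
  proof -
    have one: "zeta 1 = 0" using zeta_basis[of 1 0] basis_0 by simp
    have ab: "a * b \<in> H (i + j)" using a b by (intro mult_graded basis_in_H)
    have eps: "\<epsilon> c = 0" if "c \<in> B k" "k > 0" for c k
      using that counit_graded basis_in_H by blast
    consider "i = 0" | "j = 0" | "i > 0" "j > 0" by blast
    then show ?thesis
    proof cases
      case 1
      with a basis_0 show ?thesis by (simp add: one counit_one)
    next
      case 2
      with b basis_0 show ?thesis by (simp add: one counit_one)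
    next
      case 3
      with a b show ?thesis using zeta_graded[OF ab] eps by simp
    qed
  qed
  then have "?L a = ?R a" if "a \<in> B i" for a i
    using that by (intro linear_eq_on_basis[OF lin_y])
  then have "(\<lambda>x. ?L x y) = (\<lambda>x. ?R x y)"
    by (intro linear_eq_on_basis[OF lin_x]) meson
  then show ?thesis by meson
qed

definition zpow :: "nat \<Rightarrow> 'h \<Rightarrow> real" where
  "zpow k = (conv zeta ^^ k) \<epsilon>"

lemma zpow_0 [simp]: "zpow 0 = \<epsilon>"
  and zpow_Suc: "zpow (Suc k) = conv zeta (zpow k)"
  by (simp_all add: zpow_def)

lemma linear_zpow: "linear (zpow k)"
  by (induction k) (simp_all add: zpow_Suc counit_linear linear_conv linear_zeta)

lemma zpow_add: "zpow (i + j) = conv (zpow i) (zpow j)"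
  by (induction i)
    (simp_all add: zpow_Suc conv_counit_left conv_assoc linear_zpow linear_zeta)

lemma zpow_Suc_right: "zpow (Suc k) = conv (zpow k) zeta"
  using zpow_add[of k 1] by (simp add: zpow_Suc conv_counit_right linear_zeta)

text \<open>In a homogeneous term of the coproduct, \<open>zeta\<close> forces degree 1 on the left
  and the induction hypothesis forces degree \<open>k\<close> on the right.\<close>

lemma zpow_graded: "x \<in> H m \<Longrightarrow> m \<noteq> k \<Longrightarrow> zpow k x = 0"
proof (induction k arbitrary: m x)
  case 0
  then show ?case using counit_graded by simp
next
  case (Suc k)
  have lin: "\<forall>\<phi>\<in>set [zeta, zpow k]. linear \<phi>" by (simp add: linear_zeta linear_zpow)
  have "tensor_eval [zeta, zpow k] (\<Delta> x) = 0"
  proof (rule linear_eq_0_on_span[OF linear_tensor_eval[OF lin] _ coprod_graded[OF Suc.prems(1)]])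
    fix t assume "t \<in> (\<Union>i\<le>m. {pure_tensor [u, v] |u v. u \<in> H i \<and> v \<in> H (m - i)})"
    then obtain i u v where t: "t = pure_tensor [u, v]" and i: "i \<le> m" "u \<in> H i" "v \<in> H (m - i)"
      by auto
    \<comment> \<open>Because \<open>i \<le> m\<close>, the subtraction is not truncated:
      \<open>i = 1\<close> and \<open>m - i = k\<close> would give \<open>m = Suc k\<close>.\<close>
    have "zeta u * zpow k v = 0"
      using zeta_graded[OF i(2)] Suc.IH[OF i(3)] i(1) Suc.prems(2) by (cases "i = 1") auto
    then show "tensor_eval [zeta, zpow k] t = 0"
      by (simp add: t tensor_eval_pure[OF lin])
  qed
  then show ?case by (simp add: zpow_Suc conv_def)
qed

text \<open>As \<open>\<Delta>\<close> is multiplicative, the outer \<open>zeta\<close> obeys the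
  Leibniz rule and the remaining \<open>zpow n\<close> the induction hypothesis; Pascal's rule
  collects the terms.\<close>

lemma zpow_mult_sum: "zpow n (x * y) = (\<Sum>k\<le>n. real (n choose k) * zpow k x * zpow (n - k) y)"
proof (induction n arbitrary: x y)
  case 0
  show ?case by (simp add: counit_mult)
next
  case (Suc n)
  have "zpow (Suc n) (x * y) = tensor_eval [zeta, zpow n] (tensor_times (\<Delta> x) (\<Delta> y))"
    by (simp add: zpow_Suc conv_def coprod_mult)
  \<comment> \<open>The two-element index set carries the two Leibniz terms: \<open>True\<close>
    lets \<open>zeta\<close> act on \<open>y\<close>, \<open>False\<close> on \<open>x\<close>. The
    binomial coefficient sits inside a functional on \<open>x\<close> to fit the shape of
    \<open>tensor_eval_times\<close>.\<close>
  also have "\<dots> = (\<Sum>i\<in>{True, False}. \<Sum>k\<le>n.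
      tensor_eval [if i then \<epsilon> else zeta, \<lambda>a. real (n choose k) * zpow k a] (\<Delta> x) *
      tensor_eval [if i then zeta else \<epsilon>, zpow (n - k)] (\<Delta> y))"
    by (rule tensor_eval_times)
      (auto simp: linear_zeta linear_zpow counit_linear zeta_mult Suc.IH
        intro: linear_compose_scale_right[OF linear_zpow, simplified])
  also have "\<dots> = (\<Sum>k\<le>n. real (n choose k) * zpow k x * zpow (Suc (n - k)) y)
      + (\<Sum>k\<le>n. real (n choose k) * zpow (Suc k) x * zpow (n - k) y)"
  proof -
    \<comment> \<open>Takes the binomial coefficient back out of the functional.\<close>
    have scale: "conv \<phi> (\<lambda>a. c * zpow k a) x = c * conv \<phi> (zpow k) x"
      if "linear \<phi>" for c \<phi> k
      unfolding conv_def
    proof (rule linear_tensor_eqI[where f = "tensor_eval _" and t = "\<Delta> x"])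
      have l: "\<forall>f\<in>set [\<phi>, \<lambda>a. c * zpow k a]. linear f"
        using that linear_compose_scale_right[OF linear_zpow] by simp
      show "linear (tensor_eval [\<phi>, \<lambda>a. c * zpow k a])" by (rule linear_tensor_eval[OF l])
      have l': "\<forall>f\<in>set [\<phi>, zpow k]. linear f" using that linear_zpow by simp
      show "linear (\<lambda>t. c * tensor_eval [\<phi>, zpow k] t)"
        using linear_compose_scale_right[OF linear_tensor_eval[OF l']] by simp
      show "tensor_eval [\<phi>, \<lambda>a. c * zpow k a] (pure_tensor xs)
          = c * tensor_eval [\<phi>, zpow k] (pure_tensor xs)" for xs
        by (auto simp: tensor_eval_pure[OF l] tensor_eval_pure[OF l'] length_Suc_conv)
    qed
    show ?thesis
      by (simp add: scale linear_zeta counit_linear conv_counit_left linear_zpow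
          zpow_Suc[symmetric] conv_def[symmetric] conv_counit_left[OF linear_zpow])
  qed
  also have "\<dots> = (\<Sum>k\<le>Suc n. real (Suc n choose k) * zpow k x * zpow (Suc n - k) y)"
  proof -
    \<comment> \<open>The added top term is zero because \<open>n choose Suc n\<close> is 0.\<close>
    have "(\<Sum>k\<le>n. real (n choose k) * zpow k x * zpow (Suc (n - k)) y)
        = (\<Sum>k\<le>Suc n. real (n choose k) * zpow k x * zpow (Suc n - k) y)"
      by (simp add: Suc_diff_le)
    \<comment> \<open>Splitting off index 0 and shifting aligns this sum with the other one, so that
      Pascal's rule adds the coefficients.\<close>
    also have "\<dots> = zpow (Suc n) y * \<epsilon> x
        + (\<Sum>k\<le>n. real (n choose Suc k) * zpow (Suc k) x * zpow (n - k) y)"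
      by (subst sum.atMost_Suc_shift) simp
    finally show ?thesis
      by (subst sum.atMost_Suc_shift)
        (simp add: sum.distrib[symmetric] algebra_simps)
  qed
  finally show ?case .
qed

text \<open>By \<open>zpow_graded\<close> only the term whose exponent is the degree of
  \<open>x\<close> survives.\<close>

lemma zpow_mult:
  assumes "x \<in> H i" "y \<in> H j"
  shows "zpow (i + j) (x * y) = real (i + j choose i) * zpow i x * zpow j y"
proof -
  have "zpow (i + j) (x * y) = (\<Sum>k\<le>i + j. real (i + j choose k) * zpow k x * zpow (i + j - k) y)"
    by (rule zpow_mult_sum)
  also have "\<dots> = (\<Sum>k\<in>{i}. real (i + j choose k) * zpow k x * zpow (i + j - k) y)"
    using zpow_graded[OF assms(1)] by (intro sum.mono_neutral_right) auto
  finally show ?thesis by simp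
qed

end

section \<open>Auxiliary facts on distributions, coordinates and multinomial coefficients\<close>

lemma pmf_embed_pmf_finite:
  assumes "finite A" "\<And>x. 0 \<le> f x" "\<And>x. x \<notin> A \<Longrightarrow> f x = 0" "sum f A = 1"
  shows "pmf (embed_pmf f) x = f x"
proof (rule pmf_embed_pmf[OF assms(2)])
  have "(\<integral>\<^sup>+x. ennreal (f x) \<partial>count_space UNIV) = (\<Sum>x\<in>A. ennreal (f x))"
    using assms(1,3) by (intro nn_integral_count_space') auto
  also have "\<dots> = 1"
    using assms by (simp add: sum_ennreal)
  finally show "(\<integral>\<^sup>+x. ennreal (f x) \<partial>count_space UNIV) = 1" .
qed

text \<open>Probabilities are at most 1, so \<open>pmf p\<close> dominates the terms and the sum
  converges absolutely. The form with \<open>infsum\<close> matches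
  \<open>mult_comult_dist\<close>.\<close>

lemma pmf_bind_eq_infsum: "pmf (bind_pmf p f) y = (\<Sum>\<^sub>\<infinity>x. pmf p x * pmf (f x) y)"
proof -
  have "Infinite_Set_Sum.abs_summable_on (\<lambda>x. pmf p x * pmf (f x) y) UNIV"
    by (rule abs_summable_on_comparison_test'[OF pmf_abs_summable[of p]])
      (simp add: mult_left_le pmf_le_1)
  then show ?thesis
    by (simp add: pmf_bind pmf_expectation_eq_infsetsum infsetsum_infsum)
qed

lemma representation_sum_scaleR:
  assumes "independent S" "finite S" "b \<in> S"
  shows "representation S (\<Sum>y\<in>S. c y *\<^sub>R y) b = c b"
proof -
  have "representation S (\<Sum>y\<in>S. c y *\<^sub>R y) b = (\<Sum>y\<in>S. representation S (c y *\<^sub>R y) b)"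
    using assms(1) by (subst representation_sum) (auto intro: span_scale span_base)
  also have "\<dots> = (\<Sum>y\<in>S. if y = b then c y else 0)"
    by (rule sum.cong)
      (auto simp: representation_scale[OF assms(1) span_base] representation_basis[OF assms(1)])
  finally show ?thesis using assms by simp
qed

text \<open>For an involution that reverses the coproduct, this moves the reversal onto the
  functionals.\<close>

lemma tensor_eval_pair_rev:
  assumes "linear \<phi>" "linear \<psi>"
  shows "tensor_eval [\<phi>, \<psi>] (tensor_rev t) = tensor_eval [\<psi>, \<phi>] t"
proof (rule linear_tensor_eqI)
  have 1: "\<forall>f\<in>set [\<phi>, \<psi>]. linear f" and 2: "\<forall>f\<in>set [\<psi>, \<phi>]. linear f"
    using assms by simp_all
  show "linear (\<lambda>t. tensor_eval [\<phi>, \<psi>] (tensor_rev t))"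
    using linear_compose[OF linear_tensor_rev linear_tensor_eval[OF 1]] by (simp add: o_def)
  show "linear (tensor_eval [\<psi>, \<phi>])"
    by (rule linear_tensor_eval[OF 2])
  fix xs
  show "tensor_eval [\<phi>, \<psi>] (tensor_rev (pure_tensor xs)) = tensor_eval [\<psi>, \<phi>] (pure_tensor xs)"
  proof (cases "length xs = 2")
    case True
    then obtain a b where "xs = [a, b]"
      by (auto simp: length_Suc_conv numeral_2_eq_2)
    then show ?thesis
      by (simp add: tensor_rev_pure tensor_eval_pure[OF 1] tensor_eval_pure[OF 2])
  next
    case False
    then show ?thesis
      by (simp add: tensor_rev_pure tensor_eval_pure[OF 1] tensor_eval_pure[OF 2])
  qed
qed

text \<open>Peeling off one part leaves the same binomial coefficient as in
  \<open>zpow_mult\<close>.\<close>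

lemma multinomial_Cons:
  "multinomial (e # E) = real (e + sum_list E choose e) * multinomial E"
  by (simp add: multinomial_def binomial_fact)

lemma multinomial_pos: "multinomial E > 0"
proof -
  have "prod_list (map fact E) > (0::real)" by (induction E) auto
  then show ?thesis by (simp add: multinomial_def)
qed

lemma apply_decorations_in_listset:
  assumes \<tau>: "\<And>k b. b \<in> B k \<Longrightarrow> \<tau> b \<in> B k" and "zs \<in> listset (map B (forget D))"
  shows "apply_decorations \<tau> D zs \<in> listset (map B (forget D))"
  using assms(2)
  by (induction D arbitrary: zs)
    (auto simp: apply_decorations_def decorated_maps_def set_Cons_def \<tau>)

section \<open>Structure constants evaluated by convolution powers\<close>

context based_hopf_algebra
begin

lemma linear_projections: "\<forall>f\<in>set (map (graded_proj H) E). linear f"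
  by (auto simp: linear_graded_proj)

lemma coprod_comp_eq:
  "coprod_comp H \<Delta> \<epsilon> E x =
     tensor_maps (map ((\<circ>) tensor_of) (map (graded_proj H) E)) (iterated_coprod \<Delta> \<epsilon> (length E) x)"
  by (simp add: coprod_comp_def o_def)

text \<open>\<open>representation\<close> is 0 outside the span, so this containment is what makes
  \<open>comult_coeff\<close> a true coordinate.\<close>

lemma coprod_comp_in_span: "coprod_comp H \<Delta> \<epsilon> E x \<in> span (pure_tensor ` listset (map B E))"
  unfolding coprod_comp_eq
proof (rule linear_image_in_span[OF linear_tensor_maps_of[OF linear_projections] tensor_in_span_pure])
  fix s :: "'h tensor" assume "s \<in> range pure_tensor"
  then obtain xs where s: "s = pure_tensor xs" by auto
  have "pure_tensor (map2 (\<lambda>f x. f x) (map (graded_proj H) E) xs) \<in> span (pure_tensor ` listset (map B E))"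
    if "length xs = length E"
    by (rule pure_tensor_in_span_listset)
      (use that in \<open>auto simp: list_all2_conv_all_nth span_basis graded_proj\<close>)
  then show "tensor_maps (map ((\<circ>) tensor_of) (map (graded_proj H) E)) s
      \<in> span (pure_tensor ` listset (map B E))"
    unfolding s tensor_maps_of_pure[OF linear_projections] by (auto simp: span_zero)
qed

lemma finite_listset_basis: "finite (listset (map B E))"
  by (rule finite_listset) (auto simp: finite_basis)

lemma listset_basis_subset: "listset (map B E) \<subseteq> lists (\<Union>n. B n)"
  by (fastforce simp: in_listset_iff list_all2_conv_all_nth in_set_conv_nth in_lists_conv_set)

lemma length_listset: "zs \<in> listset (map B E) \<Longrightarrow> length zs = length E"
  by (auto simp: in_listset_iff dest: list_all2_lengthD)

lemma coprod_comp_expand: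
  "coprod_comp H \<Delta> \<epsilon> E x =
     (\<Sum>zs\<in>listset (map B E). comult_coeff H \<Delta> \<epsilon> B E x zs *\<^sub>R pure_tensor zs)"
proof -
  let ?L = "listset (map B E)"
  note BB = independent_Union_basis span_Union_basis
  have "coprod_comp H \<Delta> \<epsilon> E x = (\<Sum>t\<in>pure_tensor ` ?L.
      representation (pure_tensor ` ?L) (coprod_comp H \<Delta> \<epsilon> E x) t *\<^sub>R t)"
    using independent_pure_tensor[OF BB listset_basis_subset] coprod_comp_in_span
    by (intro sum_representation_eq[symmetric]) (auto simp: finite_listset_basis)
  also have "\<dots> = (\<Sum>zs\<in>?L. comult_coeff H \<Delta> \<epsilon> B E x zs *\<^sub>R pure_tensor zs)"
    using inj_on_subset[OF inj_on_pure_tensor[OF BB] listset_basis_subset]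
    by (simp add: sum.reindex comult_coeff_def)
  finally show ?thesis .
qed

lemma foldr_conv_zpow: "foldr conv (map zpow E) \<epsilon> = zpow (sum_list E)"
  by (induction E) (simp_all add: zpow_add)

text \<open>The left side evaluates \<open>coprod_comp\<close> at a tensor product of powers of
  \<open>zeta\<close>, and the exponents add under convolution. It yields the total mass of the
  splitting step.\<close>

lemma sum_comult_coeff_zpow:
  "(\<Sum>zs\<in>listset (map B E). comult_coeff H \<Delta> \<epsilon> B E x zs * prod_list (map2 zpow E zs))
     = zpow (sum_list E) x"
proof -
  have lin: "\<forall>\<phi>\<in>set (map zpow E). linear \<phi>" by (auto simp: linear_zpow)
  have eval: "tensor_eval (map zpow E) (pure_tensor zs) = prod_list (map2 zpow E zs)"
    if "zs \<in> listset (map B E)" for zs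
    using length_listset[OF that]
    by (simp add: tensor_eval_pure[OF lin] zip_map1 split_def o_def)
  have "(\<Sum>zs\<in>listset (map B E). comult_coeff H \<Delta> \<epsilon> B E x zs * prod_list (map2 zpow E zs))
      = tensor_eval (map zpow E) (coprod_comp H \<Delta> \<epsilon> E x)"
    unfolding coprod_comp_expand
    by (simp add: linear_sum[OF linear_tensor_eval[OF lin]] linear_scale[OF linear_tensor_eval[OF lin]]
        eval)
  also have "\<dots> = tensor_eval (map2 (\<circ>) (map zpow E) (map (graded_proj H) E))
      (iterated_coprod \<Delta> \<epsilon> (length E) x)"
    unfolding coprod_comp_eq by (rule tensor_eval_maps_of[OF linear_projections lin]) simp
  \<comment> \<open>Each \<open>zpow e\<close> vanishes outside degree \<open>e\<close>, so it
    absorbs the projection to that degree.\<close>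
  also have "map2 (\<circ>) (map zpow E) (map (graded_proj H) E) = map zpow E"
    by (simp add: list_eq_iff_nth_eq comp_graded_proj_eq linear_zpow zpow_graded)
  also have "tensor_eval (map zpow E) (iterated_coprod \<Delta> \<epsilon> (length E) x) = zpow (sum_list E) x"
    using tensor_eval_iterated_coprod[OF lin, of x] by (simp add: foldr_conv_zpow)
  finally show ?thesis .
qed

text \<open>This is the preceding sum with all parts 1; every weight is then 1, because
  \<open>zpow (Suc 0)\<close> is \<open>zeta\<close>.\<close>

lemma eta_eq_zpow:
  assumes "x \<in> B j"
  shows "eta H \<Delta> \<epsilon> B j x = zpow j x"
proof (cases "j = 0")
  case True
  \<comment> \<open>In degree 0 the value 1 set by \<open>eta\<close> agrees with the counit, as the
    only basis element is 1.\<close>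
  with assms basis_0 show ?thesis by (simp add: eta_def counit_one)
next
  case False
  have zpow_1: "zpow (Suc 0) = zeta"
    by (simp add: zpow_Suc conv_counit_right linear_zeta)
  have one: "prod_list (map2 zpow (replicate j 1) zs) = 1" if "zs \<in> listset (replicate j (B 1))" for zs
    using that by (induction j arbitrary: zs) (auto simp: set_Cons_def zpow_1 zeta_basis)
  have "eta H \<Delta> \<epsilon> B j x = (\<Sum>zs\<in>listset (map B (replicate j 1)).
      comult_coeff H \<Delta> \<epsilon> B (replicate j 1) x zs * prod_list (map2 zpow (replicate j 1) zs))"
    using False by (auto simp: eta_def one[simplified] intro!: sum.cong)
  also have "\<dots> = zpow j x"
    by (subst sum_comult_coeff_zpow) (simp add: sum_list_replicate)
  finally show ?thesis .
qed

lemma eta_prod_eq_zpow: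
  "zs \<in> listset (map B E) \<Longrightarrow> eta_prod H \<Delta> \<epsilon> B E zs = prod_list (map2 zpow E zs)"
  by (induction E arbitrary: zs) (auto simp: eta_prod_def set_Cons_def eta_eq_zpow)

lemma prod_list_graded: "zs \<in> listset (map B E) \<Longrightarrow> prod_list zs \<in> H (sum_list E)"
proof (induction E arbitrary: zs)
  case Nil
  then show ?case by (simp add: connected span_base)
qed (auto simp: set_Cons_def basis_in_H intro!: mult_graded)

text \<open>Multiplying one factor at a time, the binomial coefficients of \<open>zpow_mult\<close>
  combine into the multinomial coefficient.\<close>

lemma zpow_prod_list:
  "zs \<in> listset (map B E) \<Longrightarrow>
     zpow (sum_list E) (prod_list zs) = multinomial E * prod_list (map2 zpow E zs)"
proof (induction E arbitrary: zs)
  case Nil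
  then show ?case by (simp add: counit_one multinomial_def)
next
  case (Cons e E)
  then obtain z zs' where zs: "zs = z # zs'" "z \<in> B e" "zs' \<in> listset (map B E)"
    by (auto simp: set_Cons_def)
  then show ?case
    using Cons.IH[of zs'] zpow_mult[OF basis_in_H prod_list_graded]
    by (simp add: multinomial_Cons)
qed

text \<open>On \<open>B n\<close> the weights are values of \<eta>, so this computes the mass of the
  merging step before normalization.\<close>

lemma sum_representation_zpow:
  assumes "p \<in> H n"
  shows "(\<Sum>y\<in>B n. representation (B n) p y * zpow n y) = zpow n p"
proof -
  have "p = (\<Sum>y\<in>B n. representation (B n) p y *\<^sub>R y)"
    using assms by (intro sum_representation_eq[symmetric])
      (auto simp: independent_basis span_basis finite_basis)
  then have "zpow n p = zpow n (\<Sum>y\<in>B n. representation (B n) p y *\<^sub>R y)" by simp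
  then show ?thesis by (simp add: linear_sum[OF linear_zpow] linear_scale[OF linear_zpow])
qed

lemma linear_linear_ext: "linear (linear_ext B \<tau>)"
  unfolding linear_ext_def by (rule linear_construct[OF independent_Union_basis])

lemma linear_ext_basis: "b \<in> B k \<Longrightarrow> linear_ext B \<tau> b = \<tau> b"
  unfolding linear_ext_def by (rule construct_basis[OF independent_Union_basis]) auto

lemma zpow_linear_ext:
  assumes \<tau>: "\<And>k b. b \<in> B k \<Longrightarrow> \<tau> b \<in> B k"
    and coalg: "coalgebra_morphism \<Delta> \<epsilon> (linear_ext B \<tau>) \<or> coalgebra_antimorphism \<Delta> \<epsilon> (linear_ext B \<tau>)"
  shows "zpow k \<circ> linear_ext B \<tau> = zpow k"
proof -
  let ?f = "linear_ext B \<tau>"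
  \<comment> \<open>\<open>\<tau>\<close> maps each \<open>B k\<close> into itself, and
    \<open>zeta\<close> is constant on each \<open>B k\<close>.\<close>
  have zeta: "zeta \<circ> ?f = zeta"
    using linear_compose[OF linear_linear_ext linear_zeta] linear_zeta
    by (rule linear_eq_on_basis) (auto simp: linear_ext_basis zeta_basis dest: \<tau>)
  have maps: "tensor_eval [\<phi>, \<psi>] (tensor_maps [tensor_of \<circ> ?f, tensor_of \<circ> ?f] t)
      = tensor_eval [\<phi> \<circ> ?f, \<psi> \<circ> ?f] t" if "linear \<phi>" "linear \<psi>" for \<phi> \<psi> t
    using tensor_eval_maps_of[of "[?f, ?f]" "[\<phi>, \<psi>]" t] that by (simp add: linear_linear_ext)
  show ?thesis
  proof (induction k)
    case 0
    show ?case
      using coalg by (auto simp: coalgebra_morphism_def coalgebra_antimorphism_def)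
  next
    case (Suc k)
    show ?case
    proof
      fix x
      from coalg show "(zpow (Suc k) \<circ> ?f) x = zpow (Suc k) x"
      proof
        assume "coalgebra_morphism \<Delta> \<epsilon> ?f"
        then have "\<Delta> (?f x) = tensor_maps [tensor_of \<circ> ?f, tensor_of \<circ> ?f] (\<Delta> x)"
          by (simp add: coalgebra_morphism_def)
        then show ?thesis
          by (simp add: zpow_Suc conv_def maps linear_zeta linear_zpow zeta Suc.IH)
      next
        assume "coalgebra_antimorphism \<Delta> \<epsilon> ?f"
        then have "\<Delta> (?f x) = tensor_rev (tensor_maps [tensor_of \<circ> ?f, tensor_of \<circ> ?f] (\<Delta> x))"
          by (simp add: coalgebra_antimorphism_def)
        \<comment> \<open>The reversal exchanges the two functionals, which puts \<open>zeta\<close>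
          on the right.\<close>
        then have "(zpow (Suc k) \<circ> ?f) x = conv (zpow k) zeta x"
          by (simp add: zpow_Suc conv_def maps linear_zeta linear_zpow zeta Suc.IH tensor_eval_pair_rev)
        then show ?thesis by (simp add: zpow_Suc_right)
      qed
    qed
  qed
qed

lemma prod_zpow_apply_decorations:
  assumes "\<And>k b. b \<in> B k \<Longrightarrow> zpow k (\<tau> b) = zpow k b" and "zs \<in> listset (map B (forget D))"
  shows "prod_list (map2 zpow (forget D) (apply_decorations \<tau> D zs))
    = prod_list (map2 zpow (forget D) zs)"
  using assms(2)
  by (induction D arbitrary: zs)
    (auto simp: apply_decorations_def decorated_maps_def set_Cons_def assms(1))

text \<open>All maps involved are linear, and on basis vectors \<open>linear_ext B \<tau>\<close> is
  \<open>\<tau>\<close> itself, so the decorations can be applied to lists of basis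
  elements.\<close>

lemma mult_comult_expand:
  "mult_comult H \<Delta> \<epsilon> (linear_ext B \<tau>) D x = (\<Sum>zs\<in>listset (map B (forget D)).
     comult_coeff H \<Delta> \<epsilon> B (forget D) x zs *\<^sub>R prod_list (apply_decorations \<tau> D zs))"
proof -
  let ?fs = "decorated_maps (linear_ext B \<tau>) D"
  have lin: "\<forall>f\<in>set ?fs. linear f"
    by (auto simp: decorated_maps_def linear_linear_ext linear_id)
  have lin': "linear (\<lambda>t. tensor_mult (tensor_maps (map ((\<circ>) tensor_of) ?fs) t))"
    using linear_compose[OF linear_tensor_maps_of[OF lin] linear_tensor_mult] by (simp add: o_def)
  have maps: "map2 (\<lambda>f x. f x) ?fs zs = apply_decorations \<tau> D zs"
    if "zs \<in> listset (map B (forget D))" for zs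
    using that by (induction D arbitrary: zs)
      (auto simp: apply_decorations_def decorated_maps_def set_Cons_def linear_ext_basis)
  have "tensor_mult (tensor_maps (map ((\<circ>) tensor_of) ?fs) (pure_tensor zs))
      = prod_list (apply_decorations \<tau> D zs)" if "zs \<in> listset (map B (forget D))" for zs
    using maps[OF that] length_listset[OF that]
    unfolding tensor_maps_of_pure[OF lin] by (simp add: tensor_mult_pure decorated_maps_def)
  then show ?thesis
    unfolding mult_comult_def coprod_comp_expand
    by (simp add: linear_sum[OF lin'] linear_scale[OF lin'])
qed

end

theorem theorem4p2:
  fixes H :: "nat \<Rightarrow> 'h::real_algebra_1 set"
    and \<Delta> :: "'h \<Rightarrow> 'h tensor"
    and \<epsilon> :: "'h \<Rightarrow> real"
    and B :: "nat \<Rightarrow> 'h set"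
    and \<tau> :: "'h \<Rightarrow> 'h"
    and n :: nat
    and P :: "decorated_composition pmf"
  assumes hopf: "graded_connected_hopf_algebra H \<Delta> \<epsilon>"
    and basis: "\<And>k. finite (B k) \<and> independent (B k) \<and> span (B k) = H k"
    and basis_0: "B 0 = {1}"
    and involution: "\<And>k b. b \<in> B k \<Longrightarrow> \<tau> b \<in> B k \<and> \<tau> (\<tau> b) = b"
    and ambimorphism: "hopf_ambimorphism \<Delta> \<epsilon> (linear_ext B \<tau>)"
    and distribution: "set_pmf P \<subseteq> signed_weak_compositions n \<or>
                       set_pmf P \<subseteq> tilde_signed_weak_compositions n"
    and mult_nonneg: "\<And>D zs y. pmf P D > 0 \<Longrightarrow> zs \<in> listset (map B (forget D)) \<Longrightarrow> y \<in> B n \<Longrightarrow>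
                       mult_coeff B n zs y \<ge> 0"
    and comult_nonneg: "\<And>D x zs. pmf P D > 0 \<Longrightarrow> x \<in> B n \<Longrightarrow> zs \<in> listset (map B (forget D)) \<Longrightarrow>
                       comult_coeff H \<Delta> \<epsilon> B (forget D) x zs \<ge> 0"
    and eta_pos: "\<And>x. x \<in> B n \<Longrightarrow> eta H \<Delta> \<epsilon> B n x > 0"
  shows "(\<forall>x\<in>B n. \<forall>y\<in>B n. transition H \<Delta> \<epsilon> B \<tau> n P x y \<ge> 0) \<and>
    (\<forall>x\<in>B n. (\<Sum>y\<in>B n. transition H \<Delta> \<epsilon> B \<tau> n P x y) = 1) \<and>
    (\<forall>x\<in>B n. \<forall>D. pmf P D > 0 \<longrightarrow>
       (\<forall>zs. split_prob H \<Delta> \<epsilon> B n D x zs \<ge> 0) \<and>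
       (\<Sum>zs\<in>listset (map B (forget D)). split_prob H \<Delta> \<epsilon> B n D x zs) = 1 \<and>
       (\<forall>zs. split_prob H \<Delta> \<epsilon> B n D x zs > 0 \<longrightarrow>
          (\<forall>y. merge_prob H \<Delta> \<epsilon> B \<tau> n D zs y \<ge> 0) \<and>
          (\<Sum>y\<in>B n. merge_prob H \<Delta> \<epsilon> B \<tau> n D zs y) = 1)) \<and>
    (\<forall>x\<in>B n. \<forall>y\<in>B n.
       transition H \<Delta> \<epsilon> B \<tau> n P x y = pmf (hopf_process H \<Delta> \<epsilon> B \<tau> n P x) y)"
proof -
  interpret based_hopf_algebra H \<Delta> \<epsilon> B
    using hopf basis basis_0 by (auto intro!: based_hopf_algebra.intro based_hopf_algebra_axioms.intro)
  let ?\<eta> = "eta H \<Delta> \<epsilon> B n"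
  let ?split = "split_prob H \<Delta> \<epsilon> B n" and ?merge = "merge_prob H \<Delta> \<epsilon> B \<tau> n"
  define L where "L D = listset (map B (forget D))" for D :: decorated_composition
  define w where "w D zs = eta_prod H \<Delta> \<epsilon> B (forget D) zs" for D :: decorated_composition and zs
  define c where "c D x zs = comult_coeff H \<Delta> \<epsilon> B (forget D) x zs" for D :: decorated_composition and x zs
  define m where "m D zs y = mult_coeff B n (apply_decorations \<tau> D zs) y"
    for D :: decorated_composition and zs y
  have fin: "finite (L D)" for D
    unfolding L_def by (rule finite_listset_basis)
  have \<tau>: "\<And>k b. b \<in> B k \<Longrightarrow> \<tau> b \<in> B k"
    using involution by blast
  have \<eta>: "?\<eta> y = zpow n y" if "y \<in> B n" for y
    using that by (rule eta_eq_zpow)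
  have zpow_\<tau>: "zpow k (\<tau> b) = zpow k b" if "b \<in> B k" for k b
  proof -
    have "zpow k \<circ> linear_ext B \<tau> = zpow k"
      using \<tau> ambimorphism by (intro zpow_linear_ext) (auto simp: hopf_ambimorphism_def)
    then have "zpow k (linear_ext B \<tau> b) = zpow k b"
      by (simp add: fun_eq_iff)
    then show ?thesis using that by (simp add: linear_ext_basis)
  qed
  have deg: "sum_list (forget D) = n" if "pmf P D > 0" for D
    using that distribution
    by (auto simp: pmf_positive_iff signed_weak_compositions_def tilde_signed_weak_compositions_def)

  have apply_in: "apply_decorations \<tau> D zs \<in> L D" if "zs \<in> L D" for D zs
    using apply_decorations_in_listset[of B \<tau>, OF \<tau>] that by (simp add: L_def)
  have m_nonneg: "m D zs y \<ge> 0" if "pmf P D > 0" "zs \<in> L D" "y \<in> B n" for D zs y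
    unfolding m_def using mult_nonneg[OF that(1) _ that(3)] apply_in[OF that(2)] by (simp add: L_def)
  \<comment> \<open>Stated without division in order to cover \<open>w D zs = 0\<close>, a case used
    when the process is compared with the matrix.\<close>
  have merge_total: "(\<Sum>y\<in>B n. m D zs y * ?\<eta> y) = multinomial (forget D) * w D zs"
    if D: "pmf P D > 0" and zs: "zs \<in> L D" for D zs
  proof -
    let ?zs = "apply_decorations \<tau> D zs"
    have zs': "?zs \<in> listset (map B (forget D))" using apply_in[OF zs] by (simp add: L_def)
    have "(\<Sum>y\<in>B n. m D zs y * ?\<eta> y) = zpow n (prod_list ?zs)"
      using sum_representation_zpow[of "prod_list ?zs" n] prod_list_graded[OF zs'] deg[OF D]
      by (simp add: m_def mult_coeff_def \<eta>)
    also have "\<dots> = multinomial (forget D) * prod_list (map2 zpow (forget D) ?zs)"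
      using zpow_prod_list[OF zs'] deg[OF D] by simp
    also have "prod_list (map2 zpow (forget D) ?zs) = w D zs"
      using prod_zpow_apply_decorations[of \<tau>, OF zpow_\<tau>] eta_prod_eq_zpow zs by (simp add: w_def L_def)
    finally show ?thesis .
  qed
  have m_eta_nonneg: "m D zs y * ?\<eta> y \<ge> 0" if "pmf P D > 0" "zs \<in> L D" "y \<in> B n" for D zs y
    using m_nonneg[OF that] eta_pos[OF that(3)] by simp
  have w_nonneg: "w D zs \<ge> 0" if "pmf P D > 0" "zs \<in> L D" for D zs
  proof -
    have "multinomial (forget D) * w D zs \<ge> 0"
      using m_eta_nonneg[OF that] by (simp add: merge_total[OF that, symmetric] sum_nonneg)
    then show ?thesis
      using multinomial_pos[of "forget D"] by (simp add: zero_le_mult_iff)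
  qed
  have split_eq: "?split D x zs = (if zs \<in> L D then 1 / ?\<eta> x * c D x zs * w D zs else 0)" for D x zs
    by (simp add: split_prob_def L_def c_def w_def)
  have merge_eq: "?merge D zs y = (if y \<in> B n
      then inverse (multinomial (forget D) * w D zs) * m D zs y * ?\<eta> y else 0)" for D zs y
    by (simp add: merge_prob_def w_def m_def)

  have split_nonneg: "?split D x zs \<ge> 0" if "x \<in> B n" "pmf P D > 0" for D x zs
    using comult_nonneg[OF that(2,1), of zs] w_nonneg[OF that(2), of zs] eta_pos[OF that(1)]
    by (simp add: split_eq c_def L_def)
  have split_sum: "(\<Sum>zs\<in>L D. ?split D x zs) = 1" if "x \<in> B n" "pmf P D > 0" for D x
  proof -
    have "(\<Sum>zs\<in>L D. c D x zs * w D zs) = ?\<eta> x"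
      using sum_comult_coeff_zpow[of "forget D" x] deg[OF that(2)] \<eta>[OF that(1)]
      by (simp add: L_def c_def w_def eta_prod_eq_zpow)
    moreover have "(\<Sum>zs\<in>L D. ?split D x zs) = 1 / ?\<eta> x * (\<Sum>zs\<in>L D. c D x zs * w D zs)"
      by (simp add: split_eq sum_distrib_left mult.assoc)
    ultimately show ?thesis using eta_pos[OF that(1)] by simp
  qed
  \<comment> \<open>Lists of nonzero splitting mass have positive weight, so on them the merging
    step is never normalized by \<open>inverse 0\<close>.\<close>
  have split_pos: "zs \<in> L D" "w D zs > 0" if "x \<in> B n" "pmf P D > 0" "?split D x zs \<noteq> 0" for D x zs
  proof -
    show "zs \<in> L D" using that(3) by (auto simp: split_eq split: if_splits)
    then show "w D zs > 0"
      using that(3) w_nonneg[OF that(2)] by (auto simp: split_eq less_le)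
  qed
  have merge_nonneg: "?merge D zs y \<ge> 0"
    if "x \<in> B n" "pmf P D > 0" "?split D x zs \<noteq> 0" for D x zs y
    using split_pos[OF that] m_nonneg[OF that(2), of zs y] eta_pos[of y] multinomial_pos[of "forget D"]
    by (simp add: merge_eq less_imp_le)
  have merge_sum: "(\<Sum>y\<in>B n. ?merge D zs y) = 1"
    if "x \<in> B n" "pmf P D > 0" "?split D x zs \<noteq> 0" for D x zs
  proof -
    have "(\<Sum>y\<in>B n. ?merge D zs y)
        = inverse (multinomial (forget D) * w D zs) * (\<Sum>y\<in>B n. m D zs y * ?\<eta> y)"
      by (simp add: merge_eq sum_distrib_left mult.assoc)
    then show ?thesis
      using merge_total[OF that(2) split_pos(1)[OF that]] split_pos(2)[OF that]
        multinomial_pos[of "forget D"] by (simp add: field_simps)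
  qed

  have pmf_split: "pmf (embed_pmf (?split D x)) zs = ?split D x zs" if "x \<in> B n" "pmf P D > 0" for D x zs
    by (rule pmf_embed_pmf_finite[OF fin[of D]])
      (use split_nonneg[OF that] split_sum[OF that] in \<open>auto simp: split_eq\<close>)
  have pmf_merge: "pmf (embed_pmf (?merge D zs)) y = ?merge D zs y"
    if "x \<in> B n" "pmf P D > 0" "?split D x zs \<noteq> 0" for D x zs y
    by (rule pmf_embed_pmf_finite[OF finite_basis[of n]])
      (use merge_nonneg[OF that] merge_sum[OF that] in \<open>auto simp: merge_eq\<close>)
  define step where "step D x = bind_pmf (embed_pmf (?split D x)) (\<lambda>zs. embed_pmf (?merge D zs))" for D x
  \<comment> \<open>The law of the outcome given \<open>D\<close> is one summand of the operator,
    rescaled by \<eta>.\<close>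
  have pmf_step: "pmf (step D x) y =
      ?\<eta> y / ?\<eta> x * (representation (B n) (mult_comult H \<Delta> \<epsilon> (linear_ext B \<tau>) D x) y / multinomial (forget D))"
    if x: "x \<in> B n" and D: "pmf P D > 0" and y: "y \<in> B n" for D x y
  proof -
    \<comment> \<open>The splitting distribution lives on the finite set \<open>L D\<close>, so the
      integral is a finite sum. For lists of zero mass nothing is known yet about
      \<open>embed_pmf (?merge D zs)\<close>, hence the case distinction below.\<close>
    have "pmf (step D x) y = (\<Sum>zs\<in>L D. ?split D x zs * pmf (embed_pmf (?merge D zs)) y)"
      unfolding step_def pmf_bind
      by (subst integral_measure_pmf[OF fin[of D]])
        (auto simp: pmf_split[OF x D] set_pmf_iff split_pos(1)[OF x D])
    also have "\<dots> = (\<Sum>zs\<in>L D. ?\<eta> y / ?\<eta> x / multinomial (forget D) * (c D x zs * m D zs y))"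
    proof (rule sum.cong[OF refl])
      fix zs assume zs: "zs \<in> L D"
      show "?split D x zs * pmf (embed_pmf (?merge D zs)) y
          = ?\<eta> y / ?\<eta> x / multinomial (forget D) * (c D x zs * m D zs y)"
      proof (cases "?split D x zs = 0")
        case False
        \<comment> \<open>Here \<open>w D zs\<close> is positive and cancels between the two
          probabilities.\<close>
        then show ?thesis
          using pmf_merge[OF x D False] split_pos(2)[OF x D False] zs y
          by (simp add: split_eq merge_eq field_simps)
      next
        case True
        then consider "c D x zs = 0" | "w D zs = 0"
          using zs eta_pos[OF x] by (auto simp: split_eq)
        then have "c D x zs * m D zs y = 0"
        proof cases
          \<comment> \<open>A vanishing weight forces every coefficient of the product to vanish, because
            these coefficients are nonnegative and the \<open>\<eta>(y)\<close> are positive.\<close>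
          case 2
          then have "(\<Sum>y\<in>B n. m D zs y * ?\<eta> y) = 0"
            using merge_total[OF D zs] by simp
          then have "m D zs y * ?\<eta> y = 0"
            using sum_nonneg_0[of "B n" "\<lambda>y. m D zs y * ?\<eta> y", OF finite_basis] m_eta_nonneg[OF D zs] y
            by blast
          then show ?thesis using eta_pos[OF y] by simp
        qed simp
        with True show ?thesis by simp
      qed
    qed
    also have "\<dots> = ?\<eta> y / ?\<eta> x / multinomial (forget D) * (\<Sum>zs\<in>L D. c D x zs * m D zs y)"
      by (simp add: sum_distrib_left)
    also have "(\<Sum>zs\<in>L D. c D x zs * m D zs y)
        = representation (B n) (mult_comult H \<Delta> \<epsilon> (linear_ext B \<tau>) D x) y"
    proof -
      \<comment> \<open>Coordinates are additive only within the span, so each product is first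
        located in degree \<open>n\<close>.\<close>
      have span: "prod_list (apply_decorations \<tau> D zs) \<in> span (B n)" if "zs \<in> L D" for zs
        using prod_list_graded[of "apply_decorations \<tau> D zs" "forget D"] apply_in[OF that] deg[OF D]
        by (simp add: L_def span_basis)
      have "representation (B n) (mult_comult H \<Delta> \<epsilon> (linear_ext B \<tau>) D x) y
          = (\<Sum>zs\<in>L D. representation (B n) (c D x zs *\<^sub>R prod_list (apply_decorations \<tau> D zs)) y)"
        unfolding mult_comult_expand L_def[symmetric] c_def[symmetric]
        by (subst representation_sum[OF independent_basis]) (auto intro: span_scale span)
      also have "\<dots> = (\<Sum>zs\<in>L D. c D x zs * m D zs y)"
        by (rule sum.cong)
          (simp_all add: representation_scale[OF independent_basis span] m_def mult_coeff_def)
      finally show ?thesis ..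
    qed
    finally show ?thesis by simp
  qed
  have process: "hopf_process H \<Delta> \<epsilon> B \<tau> n P x = bind_pmf P (\<lambda>D. step D x)" for x
    by (simp add: hopf_process_def step_def)
  have transition_eq: "transition H \<Delta> \<epsilon> B \<tau> n P x y = pmf (hopf_process H \<Delta> \<epsilon> B \<tau> n P x) y"
    if x: "x \<in> B n" and y: "y \<in> B n" for x y
  proof -
    have "transition H \<Delta> \<epsilon> B \<tau> n P x y = ?\<eta> y / ?\<eta> x * (\<Sum>\<^sub>\<infinity>D. pmf P D / multinomial (forget D) *
        representation (B n) (mult_comult H \<Delta> \<epsilon> (linear_ext B \<tau>) D x) y)"
      unfolding transition_def mult_comult_dist_def
      by (simp add: representation_sum_scaleR[OF independent_basis finite_basis y])
    \<comment> \<open>Over the reals a constant factor passes through \<open>infsum\<close> without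
      a proof of summability.\<close>
    also have "\<dots> = (\<Sum>\<^sub>\<infinity>D. ?\<eta> y / ?\<eta> x * (pmf P D / multinomial (forget D) *
        representation (B n) (mult_comult H \<Delta> \<epsilon> (linear_ext B \<tau>) D x) y))"
      by (rule infsum_cmult_right'[symmetric])
    also have "\<dots> = (\<Sum>\<^sub>\<infinity>D. pmf P D * pmf (step D x) y)"
    proof (rule infsum_cong)
      fix D
      \<comment> \<open>Outside the support of \<open>P\<close> both sides are 0; on the support
        \<open>pmf_step\<close> applies.\<close>
      show "?\<eta> y / ?\<eta> x * (pmf P D / multinomial (forget D) *
          representation (B n) (mult_comult H \<Delta> \<epsilon> (linear_ext B \<tau>) D x) y) = pmf P D * pmf (step D x) y"
        using pmf_step[OF x _ y, of D] pmf_nonneg[of P D] by (cases "pmf P D = 0") auto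
    qed
    finally show ?thesis by (simp add: process pmf_bind_eq_infsum)
  qed
  \<comment> \<open>The process never leaves \<open>B n\<close>, so its probabilities over
    \<open>B n\<close> sum to 1, which gives the row sums.\<close>
  have set_process: "set_pmf (hopf_process H \<Delta> \<epsilon> B \<tau> n P x) \<subseteq> B n" if x: "x \<in> B n" for x
  proof
    fix y assume "y \<in> set_pmf (hopf_process H \<Delta> \<epsilon> B \<tau> n P x)"
    then obtain D zs where D: "D \<in> set_pmf P" and zs: "zs \<in> set_pmf (embed_pmf (?split D x))"
      and y: "y \<in> set_pmf (embed_pmf (?merge D zs))"
      by (auto simp: process step_def)
    have D': "pmf P D > 0" using D by (rule pmf_positive)
    then have "?split D x zs \<noteq> 0" using zs pmf_split[OF x] by (simp add: set_pmf_iff)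
    then have "?merge D zs y \<noteq> 0" using y pmf_merge[OF x D'] by (simp add: set_pmf_iff)
    then show "y \<in> B n" by (auto simp: merge_eq split: if_splits)
  qed
  show ?thesis
  proof (intro conjI ballI allI impI)
    fix x y assume "x \<in> B n" "y \<in> B n"
    then show "transition H \<Delta> \<epsilon> B \<tau> n P x y = pmf (hopf_process H \<Delta> \<epsilon> B \<tau> n P x) y"
      by (rule transition_eq)
    then show "transition H \<Delta> \<epsilon> B \<tau> n P x y \<ge> 0" by simp
  next
    fix x assume x: "x \<in> B n"
    then show "(\<Sum>y\<in>B n. transition H \<Delta> \<epsilon> B \<tau> n P x y) = 1"
      using sum_pmf_eq_1[OF finite_basis set_process[OF x]] by (simp add: transition_eq)
  next
    fix x D assume xD: "x \<in> B n" "pmf P D > 0"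
    show "?split D x zs \<ge> 0" for zs using split_nonneg[OF xD] .
    show "(\<Sum>zs\<in>listset (map B (forget D)). ?split D x zs) = 1"
      using split_sum[OF xD] by (simp add: L_def)
    fix zs assume pos: "?split D x zs > 0"
    show "?merge D zs y \<ge> 0" for y using merge_nonneg[OF xD] pos by simp
    show "(\<Sum>y\<in>B n. ?merge D zs y) = 1" using merge_sum[OF xD] pos by simp
  qed
qed

end
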